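(* Let $(M,g)$ be a Riemannian manifold with a bundle-like foliation $\mathbf F$. Assume that $\mathbf F$ has totally umbilical leaves and that $X,Y$ are basic vector fields. Then $A_XY$ is a Killing vector field along leaves if and only if $g(D_X\tau,Y)=g(D_Y\tau,X)$.
   Context: All objects are $C^\infty$. $\mathbf F$ has leaf dimension $p\ge 1$. $\mathbf V$ is the distribution tangent to $\mathbf F$, $\mathbf H=\mathbf V^\perp$ its orthogonal complement; $\mathcal V E,\mathcal H E$ are the projections of $E$ to $\mathbf V,\mathbf H$. Sections of $\mathbf V$ (resp. $\mathbf H$) are vertical (resp. horizontal). A (local) basic vector field is a horizontal vector field which projects to a well-defined vector field under the local submersions defining $\mathbf F$. $\mathbf F$ is bundle-like with respect to $g$ if $W\,g(X,X)=0$ for every local basic $X$ and vertical $W$. $D$ is the Levi-Civita connection of $g$. The O'Neill tensors are $T_EF=\mathcal V D_{\mathcal V E}\mathcal H F+\mathcal H D_{\mathcal V E}\mathcal V F$ and $A_EF=\mathcal V D_{\mathcal H E}\mathcal H F+\mathcal H D_{\mathcal H E}\mathcal V F$. The mean curvature vector field is $\tau=\sum_{i=1}^pT_{V_i}V_i$ for a local orthonormal frame $\{V_i\}$ of $\mathbf V$. The leaves are totally umbilical if $T_UV=\frac1p g(U,V)\tau$ for all vertical $U,V$. A vertical vector field $W$ is Killing along leaves if its restriction to each leaf is Killing for the induced metric, i.e. $g(D_UW,V)+g(D_VW,U)=0$ for all vertical $U,V$. *)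

theory Defs
  imports "HOL-Analysis.Analysis" "HOL-Library.Function_Algebras"
begin

text \<open>Only meant for open \<open>S\<close>, since the derivatives are unrestricted ones.\<close>

primrec C_k_on ::
    "nat \<Rightarrow> ('m::euclidean_space \<Rightarrow> 'n::real_normed_vector) \<Rightarrow> 'm set \<Rightarrow> bool" where
  "C_k_on 0 f S \<longleftrightarrow> continuous_on S f"
| "C_k_on (Suc k) f S \<longleftrightarrow>
     (\<forall>u\<in>S. f differentiable (at u)) \<and>
     (\<forall>v. C_k_on k (\<lambda>u. frechet_derivative f (at u) v) S)"

definition smooth_on :: "('m::euclidean_space \<Rightarrow> 'n::real_normed_vector) \<Rightarrow> 'm set \<Rightarrow> bool" where
  "smooth_on f S \<longleftrightarrow> (\<forall>k. C_k_on k f S)"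

text \<open>A chart is a pair of its domain and its coordinate map; only the values of the coordinate
  map on the domain matter.\<close>

type_synonym ('a, 'm) chart = "'a set \<times> ('a \<Rightarrow> 'm)"

abbreviation dom_chart :: "('a, 'm) chart \<Rightarrow> 'a set" where
  "dom_chart c \<equiv> fst c"

abbreviation coords :: "('a, 'm) chart \<Rightarrow> 'a \<Rightarrow> 'm" where
  "coords c \<equiv> snd c"

definition param :: "('a, 'm) chart \<Rightarrow> 'm \<Rightarrow> 'a" where
  "param c = inv_into (dom_chart c) (coords c)"

definition is_chart :: "('a::topological_space, 'm::euclidean_space) chart \<Rightarrow> bool" where
  "is_chart c \<longleftrightarrow>
     open (dom_chart c) \<and> open (coords c ` dom_chart c) \<and>
     homeomorphism (dom_chart c) (coords c ` dom_chart c) (coords c) (param c)"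

definition smooth_atlas :: "('a::topological_space, 'm::euclidean_space) chart set \<Rightarrow> bool" where
  "smooth_atlas \<A> \<longleftrightarrow>
     (\<forall>c\<in>\<A>. is_chart c) \<and> (\<Union>c\<in>\<A>. dom_chart c) = UNIV \<and>
     (\<forall>c\<in>\<A>. \<forall>d\<in>\<A>.
        smooth_on (coords d \<circ> param c) (coords c ` (dom_chart c \<inter> dom_chart d)))"

text \<open>A tangent vector at \<open>x\<close> is represented by the derivation it induces on the functions that
  are smooth near \<open>x\<close>; it is extended by \<open>0\<close> to all other functions, so that equality of tangent
  vectors is equality of functions. A vector field on an open set \<open>W\<close> is a function on all points
  whose values outside \<open>W\<close> are irrelevant. Addition, subtraction and \<open>0\<close> of tangent vectors and
  of vector fields are the pointwise operations on functions.\<close>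

type_synonym 'a tangent = "('a \<Rightarrow> real) \<Rightarrow> real"
type_synonym 'a vfield = "'a \<Rightarrow> 'a tangent"

definition scale :: "real \<Rightarrow> 'a tangent \<Rightarrow> 'a tangent" where
  "scale r v = (\<lambda>f. r * v f)"

definition fscale :: "('a \<Rightarrow> real) \<Rightarrow> 'a vfield \<Rightarrow> 'a vfield" where
  "fscale f X = (\<lambda>x. scale (f x) (X x))"

locale smooth_manifold =
  fixes \<A> :: "('a::{t2_space, second_countable_topology}, 'm::euclidean_space) chart set"
  assumes smooth_atlas: "smooth_atlas \<A>"
begin

definition smooth_fun :: "'a set \<Rightarrow> ('a \<Rightarrow> real) \<Rightarrow> bool" where
  "smooth_fun W f \<longleftrightarrow>
     open W \<and> (\<forall>c\<in>\<A>. smooth_on (f \<circ> param c) (coords c ` (dom_chart c \<inter> W)))"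

definition smooth_at :: "'a \<Rightarrow> ('a \<Rightarrow> real) \<Rightarrow> bool" where
  "smooth_at x f \<longleftrightarrow> (\<exists>W. x \<in> W \<and> smooth_fun W f)"

text \<open>The vector \<open>\<Sum>\<^sub>i \<xi>\<^sub>i \<partial>/\<partial>x\<^sub>i\<close> at \<open>x\<close> for the coordinates \<open>(x\<^sub>i)\<close> of the chart \<open>c\<close>.\<close>

definition coord_vector :: "('a, 'm) chart \<Rightarrow> 'a \<Rightarrow> 'm \<Rightarrow> 'a tangent" where
  "coord_vector c x \<xi> =
     (\<lambda>f. if smooth_at x f then frechet_derivative (f \<circ> param c) (at (coords c x)) \<xi> else 0)"

definition tangent_space :: "'a \<Rightarrow> 'a tangent set" where
  "tangent_space x = {coord_vector c x \<xi> | c \<xi>. c \<in> \<A> \<and> x \<in> dom_chart c}"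

definition vector_fields :: "'a set \<Rightarrow> 'a vfield set" where
  "vector_fields W = {X. open W \<and> (\<forall>x\<in>W. X x \<in> tangent_space x) \<and>
     (\<forall>W' f. W' \<subseteq> W \<longrightarrow> smooth_fun W' f \<longrightarrow> smooth_fun W' (\<lambda>x. X x f))}"

text \<open>The guard keeps the convention that tangent vectors vanish on functions that are not smooth
  near the point.\<close>

definition lie_bracket :: "'a vfield \<Rightarrow> 'a vfield \<Rightarrow> 'a vfield" where
  "lie_bracket X Y =
     (\<lambda>x f. if smooth_at x f then X x (\<lambda>y. Y y f) - Y x (\<lambda>y. X y f) else 0)"

definition riemannian_metric :: "('a \<Rightarrow> 'a tangent \<Rightarrow> 'a tangent \<Rightarrow> real) \<Rightarrow> bool" where
  "riemannian_metric g \<longleftrightarrow>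
     (\<forall>x. \<forall>u\<in>tangent_space x. \<forall>v\<in>tangent_space x. g x u v = g x v u) \<and>
     (\<forall>x. \<forall>u\<in>tangent_space x. \<forall>v\<in>tangent_space x. \<forall>w\<in>tangent_space x. \<forall>r.
        g x (scale r u + v) w = r * g x u w + g x v w) \<and>
     (\<forall>x. \<forall>v\<in>tangent_space x. v \<noteq> 0 \<longrightarrow> g x v v > 0) \<and>
     (\<forall>W. \<forall>X\<in>vector_fields W. \<forall>Y\<in>vector_fields W. smooth_fun W (\<lambda>x. g x (X x) (Y x)))"

text \<open>\<open>D X Y\<close> stands for \<open>D\<^sub>X Y\<close>. The axioms are imposed on the vector fields on every open set
  \<open>W\<close>; together with the extensional representation of vector fields they force \<open>D\<close> to be
  local.\<close>

definition affine_connection :: "('a vfield \<Rightarrow> 'a vfield \<Rightarrow> 'a vfield) \<Rightarrow> bool" where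
  "affine_connection D \<longleftrightarrow>
     (\<forall>W. \<forall>X\<in>vector_fields W. \<forall>Y\<in>vector_fields W. D X Y \<in> vector_fields W) \<and>
     (\<forall>W. \<forall>X\<in>vector_fields W. \<forall>X'\<in>vector_fields W. \<forall>Y\<in>vector_fields W. \<forall>x\<in>W.
        D (X + X') Y x = D X Y x + D X' Y x) \<and>
     (\<forall>W f. \<forall>X\<in>vector_fields W. \<forall>Y\<in>vector_fields W. smooth_fun W f \<longrightarrow>
        (\<forall>x\<in>W. D (fscale f X) Y x = scale (f x) (D X Y x))) \<and>
     (\<forall>W. \<forall>X\<in>vector_fields W. \<forall>Y\<in>vector_fields W. \<forall>Y'\<in>vector_fields W. \<forall>x\<in>W.
        D X (Y + Y') x = D X Y x + D X Y' x) \<and>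
     (\<forall>W f. \<forall>X\<in>vector_fields W. \<forall>Y\<in>vector_fields W. smooth_fun W f \<longrightarrow>
        (\<forall>x\<in>W. D X (fscale f Y) x = scale (X x f) (Y x) + scale (f x) (D X Y x)))"

definition levi_civita ::
    "('a \<Rightarrow> 'a tangent \<Rightarrow> 'a tangent \<Rightarrow> real) \<Rightarrow> ('a vfield \<Rightarrow> 'a vfield \<Rightarrow> 'a vfield) \<Rightarrow> bool"
    where
  "levi_civita g D \<longleftrightarrow>
     affine_connection D \<and>
     (\<forall>W. \<forall>X\<in>vector_fields W. \<forall>Y\<in>vector_fields W. \<forall>x\<in>W.
        D X Y x - D Y X x = lie_bracket X Y x) \<and>
     (\<forall>W. \<forall>X\<in>vector_fields W. \<forall>Y\<in>vector_fields W. \<forall>Z\<in>vector_fields W. \<forall>x\<in>W.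
        X x (\<lambda>y. g y (Y y) (Z y)) = g x (D X Y x) (Z x) + g x (Y x) (D X Z x))"

end

text \<open>The transverse coordinates of a point of the model space, where the leaf coordinates are
  those along the basis vectors in \<open>B\<close>.\<close>

definition transverse :: "'m::euclidean_space set \<Rightarrow> 'm \<Rightarrow> 'm" where
  "transverse B u = (\<Sum>b\<in>Basis - B. (u \<bullet> b) *\<^sub>R b)"

text \<open>A foliation with leaf dimension \<open>p\<close> is given by a foliated atlas \<open>\<F>\<close>, compatible with the
  smooth structure, in which the coordinate directions \<open>B\<close> are tangent to the leaves: locally, the
  transverse coordinates in one chart are a function of the transverse coordinates in any other.
  The maps \<open>transverse B \<circ> coords c\<close>, restricted to small open sets, are the local submersions
  defining the foliation. Codimension \<open>0\<close> (\<open>B = Basis\<close>) is allowed.\<close>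

locale foliated_manifold = smooth_manifold \<A>
  for \<A> :: "('a::{t2_space, second_countable_topology}, 'm::euclidean_space) chart set" +
  fixes \<F> :: "('a, 'm) chart set" and B :: "'m set" and p :: nat
  assumes foliated_atlas_compatible: "smooth_atlas (\<A> \<union> \<F>)"
    and foliated_atlas_cover: "(\<Union>c\<in>\<F>. dom_chart c) = UNIV"
    and leaf_directions: "B \<subseteq> Basis"
    and leaf_dimension: "card B = p" "p \<ge> 1"
    and foliated_transitions:
      "\<And>c d x. c \<in> \<F> \<Longrightarrow> d \<in> \<F> \<Longrightarrow> x \<in> dom_chart c \<inter> dom_chart d \<Longrightarrow>
         \<exists>N h. open N \<and> x \<in> N \<and> N \<subseteq> dom_chart c \<inter> dom_chart d \<and>
           (\<forall>y\<in>N. transverse B (coords d y) = h (transverse B (coords c y)))"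
begin

definition vertical_space :: "'a \<Rightarrow> 'a tangent set" where
  "vertical_space x = {v \<in> tangent_space x.
     \<forall>c\<in>\<F>. x \<in> dom_chart c \<longrightarrow> (\<forall>b\<in>Basis - B. v (\<lambda>y. coords c y \<bullet> b) = 0)}"

definition vertical_fields :: "'a set \<Rightarrow> 'a vfield set" where
  "vertical_fields W = {X \<in> vector_fields W. \<forall>x\<in>W. X x \<in> vertical_space x}"

text \<open>\<open>X\<close> projects to a well-defined vector field \<open>\<Xi>\<close> under the local submersions; smoothness of
  \<open>\<Xi>\<close> is automatic, since the submersions have smooth local sections.\<close>

definition projectable :: "'a set \<Rightarrow> 'a vfield \<Rightarrow> bool" where
  "projectable W X \<longleftrightarrow>
     (\<forall>c\<in>\<F>. \<forall>x\<in>W \<inter> dom_chart c. \<exists>N \<Xi>. open N \<and> x \<in> N \<and> N \<subseteq> W \<inter> dom_chart c \<and>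
        (\<forall>y\<in>N. \<forall>b\<in>Basis - B.
           X y (\<lambda>z. coords c z \<bullet> b) = \<Xi> (transverse B (coords c y)) \<bullet> b))"

end

locale foliated_riemannian = foliated_manifold \<A> \<F> B p
  for \<A> :: "('a::{t2_space, second_countable_topology}, 'm::euclidean_space) chart set"
    and \<F> B p +
  fixes g :: "'a \<Rightarrow> 'a tangent \<Rightarrow> 'a tangent \<Rightarrow> real"
    and D :: "'a vfield \<Rightarrow> 'a vfield \<Rightarrow> 'a vfield"
  assumes metric: "riemannian_metric g"
    and levi_civita: "levi_civita g D"
begin

definition horizontal_space :: "'a \<Rightarrow> 'a tangent set" where
  "horizontal_space x = {v \<in> tangent_space x. \<forall>u\<in>vertical_space x. g x v u = 0}"

definition horizontal_fields :: "'a set \<Rightarrow> 'a vfield set" where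
  "horizontal_fields W = {X \<in> vector_fields W. \<forall>x\<in>W. X x \<in> horizontal_space x}"

definition vert :: "'a vfield \<Rightarrow> 'a vfield" where
  "vert E = (\<lambda>x. THE v. v \<in> vertical_space x \<and> E x - v \<in> horizontal_space x)"

definition hor :: "'a vfield \<Rightarrow> 'a vfield" where
  "hor E = E - vert E"

definition basic_fields :: "'a set \<Rightarrow> 'a vfield set" where
  "basic_fields W = {X \<in> horizontal_fields W. projectable W X}"

definition bundle_like :: bool where
  "bundle_like \<longleftrightarrow>
     (\<forall>W. \<forall>X\<in>basic_fields W. \<forall>V\<in>vertical_fields W. \<forall>x\<in>W. V x (\<lambda>y. g y (X y) (X y)) = 0)"

definition oneill_T :: "'a vfield \<Rightarrow> 'a vfield \<Rightarrow> 'a vfield" where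
  "oneill_T E G = vert (D (vert E) (hor G)) + hor (D (vert E) (vert G))"

definition oneill_A :: "'a vfield \<Rightarrow> 'a vfield \<Rightarrow> 'a vfield" where
  "oneill_A E G = vert (D (hor E) (hor G)) + hor (D (hor E) (vert G))"

definition vertical_frame :: "'a set \<Rightarrow> (nat \<Rightarrow> 'a vfield) \<Rightarrow> bool" where
  "vertical_frame W V \<longleftrightarrow>
     (\<forall>i\<in>{1..p}. V i \<in> vertical_fields W) \<and>
     (\<forall>x\<in>W. \<forall>i\<in>{1..p}. \<forall>j\<in>{1..p}. g x (V i x) (V j x) = (if i = j then 1 else 0))"

definition mean_curvature :: "'a vfield" where
  "mean_curvature = (\<lambda>x. THE t. \<forall>W V. x \<in> W \<longrightarrow> vertical_frame W V \<longrightarrow>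
     t = (\<Sum>i=1..p. oneill_T (V i) (V i) x))"

definition totally_umbilical :: bool where
  "totally_umbilical \<longleftrightarrow>
     (\<forall>W. \<forall>U\<in>vertical_fields W. \<forall>V\<in>vertical_fields W. \<forall>x\<in>W.
        oneill_T U V x = scale (1 / real p * g x (U x) (V x)) (mean_curvature x))"

definition killing_along_leaves :: "'a set \<Rightarrow> 'a vfield \<Rightarrow> bool" where
  "killing_along_leaves W K \<longleftrightarrow>
     K \<in> vertical_fields W \<and>
     (\<forall>W'\<subseteq>W. \<forall>U\<in>vertical_fields W'. \<forall>V\<in>vertical_fields W'. \<forall>x\<in>W'.
        g x (D U K x) (V x) + g x (D V K x) (U x) = 0)"

end

end

theory Submission
  imports Defs
begin

text \<open>Let \<open>L\<^sub>Z g\<close> be the Lie derivative of the metric, restricted to vertical fields. For a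
  horizontal field \<open>Z\<close> and vertical \<open>U\<close>, \<open>V\<close> it is \<open>- 2 g(Z, T\<^sub>U V)\<close>, so on umbilical leaves
  \<open>L\<^sub>Z g = f\<^sub>Z g\<close> with \<open>f\<^sub>Z = - (2/p) g(Z,\<tau>)\<close>
  (\<open>metric_lie_horizontal_umbilical\<close>): horizontal fields deform the leaves
  conformally. For basic \<open>X\<close> the bracket with a vertical field is vertical again, so the commutator
  rule \<open>L\<^bsub>[X,Y]\<^esub> = [L\<^sub>X, L\<^sub>Y]\<close> makes sense on vertical fields and gives
  \<open>L\<^bsub>[X,Y]\<^esub> g = (X f\<^sub>Y - Y f\<^sub>X) g\<close> (\<open>metric_lie_bracket_conformal\<close>).

  On the other hand, the foliation being bundle-like makes \<open>A\<^sub>X Y\<close> skew in basic \<open>X\<close> and \<open>Y\<close>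
  (\<open>connection_basic_skew\<close>), so \<open>[X,Y] = 2 A\<^sub>X Y + H\<close> with \<open>H\<close> horizontal, and
  \<open>L\<^sub>H g = f\<^sub>H g\<close>. Comparing the two expressions,
  \<open>2 L\<^sub>A g = (X f\<^sub>Y - Y f\<^sub>X - f\<^sub>H) g\<close> for \<open>A = A\<^sub>X Y\<close>. Since \<open>D\<close> is metric and torsion-free, the
  factor is \<open>- (2/p) (g(D\<^sub>X \<tau>, Y) - g(D\<^sub>Y \<tau>, X))\<close> (\<open>metric_lie_oneill_A\<close>). As the leaves have
  positive dimension, \<open>g\<close> is not zero on vertical vectors, and the Killing equation for
  \<open>A\<^sub>X Y\<close> is the vanishing of this factor.

  Two facts allow this computation with smooth fields on open sets. Vertical and horizontal
  parts of smooth fields are smooth, by a Gram-Schmidt process in foliated charts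
  (\<open>coord_plane_projection\<close>). The value of \<open>D\<close> on an open set depends only on the fields on that set (\<open>connection_cong\<close>), so that
  vertical fields need to be given only locally.\<close>

section \<open>Calculus of \<open>C\<^sup>k\<close> functions\<close>

lemma C_k_on_cong:
  assumes "open S" "\<And>u. u \<in> S \<Longrightarrow> f u = h u" "C_k_on k f S"
  shows "C_k_on k h S"
  using assms(2,3)
proof (induction k arbitrary: f h)
  case 0
  then show ?case by (auto cong: continuous_on_cong)
next
  case (Suc k)
  have deriv: "(h has_derivative frechet_derivative f (at u)) (at u)" if "u \<in> S" for u
  proof -
    have "(f has_derivative frechet_derivative f (at u)) (at u)"
      using Suc.prems(2) that by (simp add: frechet_derivative_works)
    then show ?thesis
      by (rule has_derivative_transform_within_open[OF _ \<open>open S\<close> that])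
        (use Suc.prems(1) in auto)
  qed
  have "C_k_on k (\<lambda>u. frechet_derivative h (at u) v) S" for v
    using Suc.IH[of "\<lambda>u. frechet_derivative f (at u) v"] Suc.prems(2)
      frechet_derivative_at[OF deriv] by auto
  then show ?case
    using deriv by (auto simp: differentiable_def)
qed

lemma C_k_on_deriv:
  assumes "C_k_on (Suc k) f S" "u \<in> S"
  shows "(f has_derivative frechet_derivative f (at u)) (at u)"
  using assms by (simp add: frechet_derivative_works)

lemma C_k_on_SucI:
  assumes "open S" "\<And>u. u \<in> S \<Longrightarrow> (f has_derivative f' u) (at u)"
    and "\<And>v. C_k_on k (\<lambda>u. f' u v) S"
  shows "C_k_on (Suc k) f S"
proof -
  have "f' u = frechet_derivative f (at u)" if "u \<in> S" for u
    using assms(2)[OF that] by (rule frechet_derivative_at)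
  then have "C_k_on k (\<lambda>u. frechet_derivative f (at u) v) S" for v
    using C_k_on_cong[OF assms(1) _ assms(3)[of v]] by auto
  then show ?thesis
    using assms(2) by (auto simp: differentiable_def)
qed

lemma C_k_on_subset: "C_k_on k f S \<Longrightarrow> T \<subseteq> S \<Longrightarrow> C_k_on k f T"
  by (induction k arbitrary: f) (auto intro: continuous_on_subset)

lemma C_k_on_SucD: "C_k_on (Suc k) f S \<Longrightarrow> C_k_on k f S"
proof (induction k arbitrary: f)
  case 0
  then show ?case
    by (auto intro!: differentiable_imp_continuous_on differentiable_at_imp_differentiable_on)
qed auto

lemma C_k_on_Union:
  assumes "\<And>S. S \<in> \<S> \<Longrightarrow> open S" "\<And>S. S \<in> \<S> \<Longrightarrow> C_k_on k f S"
  shows "C_k_on k f (\<Union>\<S>)"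
  using assms(2)
proof (induction k arbitrary: f)
  case 0
  then show ?case using assms(1) by (auto intro!: continuous_on_open_Union)
qed auto

lemma C_k_on_const: "open S \<Longrightarrow> C_k_on k (\<lambda>_. c) S"
  by (induction k arbitrary: c) auto

lemma C_k_on_add:
  assumes "open S"
  shows "C_k_on k f S \<Longrightarrow> C_k_on k h S \<Longrightarrow> C_k_on k (\<lambda>u. f u + h u) S"
proof (induction k arbitrary: f h)
  case 0
  then show ?case by (auto intro: continuous_intros)
next
  case (Suc k)
  show ?case
    by (rule C_k_on_SucI[OF assms has_derivative_add])
      (use Suc.prems C_k_on_deriv in \<open>auto intro!: Suc.IH assms\<close>)
qed

lemma C_k_on_linear:
  assumes "open S" "bounded_linear L"
  shows "C_k_on k f S \<Longrightarrow> C_k_on k (\<lambda>u. L (f u)) S"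
proof (induction k arbitrary: f)
  case 0
  then show ?case using bounded_linear.continuous_on[OF assms(2)] by auto
next
  case (Suc k)
  show ?case
    by (rule C_k_on_SucI[OF assms(1) bounded_linear.has_derivative[OF assms(2)]])
      (use Suc.prems C_k_on_deriv in \<open>auto intro!: Suc.IH assms\<close>)
qed

lemma C_k_on_scaleR:
  assumes "open S"
  shows "C_k_on k f S \<Longrightarrow> C_k_on k h S \<Longrightarrow> C_k_on k (\<lambda>u. (f u :: real) *\<^sub>R h u) S"
proof (induction k arbitrary: f h)
  case 0
  then show ?case by (auto intro: continuous_intros)
next
  case (Suc k)
  then have "C_k_on k f S" "C_k_on k h S"
    using C_k_on_SucD by blast+
  then show ?case
    by (intro C_k_on_SucI[OF assms has_derivative_scaleR])
      (use Suc.prems C_k_on_deriv in \<open>auto intro!: Suc.IH C_k_on_add assms\<close>)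
qed

lemma C_k_on_inverse:
  assumes "open S"
  shows "C_k_on k f S \<Longrightarrow> (\<And>u. u \<in> S \<Longrightarrow> f u \<noteq> 0) \<Longrightarrow> C_k_on k (\<lambda>u. inverse (f u :: real)) S"
proof (induction k arbitrary: f)
  case 0
  then show ?case by (auto intro: continuous_intros)
next
  case (Suc k)
  then have inv: "C_k_on k (\<lambda>u. inverse (f u)) S"
    using C_k_on_SucD by blast
  define f' where "f' u v = - (inverse (f u) * frechet_derivative f (at u) v * inverse (f u))" for u v
  have derivs: "C_k_on k (\<lambda>u. f' u v) S" for v
    unfolding f'_def
  proof (rule C_k_on_linear[OF assms bounded_linear_minus[OF bounded_linear_ident]])
    show "C_k_on k (\<lambda>u. inverse (f u) * frechet_derivative f (at u) v * inverse (f u)) S"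
      using C_k_on_scaleR[OF assms C_k_on_scaleR[OF assms inv, of "\<lambda>u. frechet_derivative f (at u) v"] inv]
        Suc.prems(1)
      by simp
  qed
  have "((\<lambda>u. inverse (f u)) has_derivative f' u) (at u)" if "u \<in> S" for u
    unfolding f'_def
    using Suc.prems(2)[OF that] C_k_on_deriv[OF Suc.prems(1) that]
    by (rule Deriv.has_derivative_inverse)
  then show ?case
    by (rule C_k_on_SucI[OF assms, of "\<lambda>u. inverse (f u)" f', OF _ derivs])
qed

lemma C_k_on_sum:
  assumes "open S" "finite I" "\<And>i. i \<in> I \<Longrightarrow> C_k_on k (f i) S"
  shows "C_k_on k (\<lambda>u. \<Sum>i\<in>I. f i u) S"
  using assms(2,3) by (induction I rule: finite_induct) (auto intro: C_k_on_const C_k_on_add assms(1))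

lemma linear_Basis_sum:
  fixes v :: "'m::euclidean_space"
  assumes "linear L"
  shows "L v = (\<Sum>b\<in>Basis. (v \<bullet> b) *\<^sub>R L b)"
proof -
  have "L v = L (\<Sum>b\<in>Basis. (v \<bullet> b) *\<^sub>R b)"
    by (simp add: euclidean_representation)
  then show ?thesis
    using assms by (simp add: linear_sum linear_scale)
qed

text \<open>The chain rule expresses a directional derivative of \<open>f \<circ> h\<close> through the partial derivatives
  of \<open>f\<close>, composed with \<open>h\<close>, and those of \<open>h\<close>; this is what makes the induction on \<open>k\<close> close.\<close>

lemma C_k_on_compose:
  fixes h :: "'k::euclidean_space \<Rightarrow> 'm::euclidean_space"
  assumes "open S" "h ` S \<subseteq> T"
  shows "C_k_on k f T \<Longrightarrow> C_k_on k h S \<Longrightarrow> C_k_on k (f \<circ> h) S"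
  using assms(2)
proof (induction k arbitrary: f)
  case 0
  then show ?case
    using continuous_on_compose[of S h f] by (auto intro: continuous_on_subset)
next
  case (Suc k)
  let ?f' = "\<lambda>y. frechet_derivative f (at y)" and ?h' = "\<lambda>u. frechet_derivative h (at u)"
  have deriv: "((f \<circ> h) has_derivative ?f' (h u) \<circ> ?h' u) (at u)" if "u \<in> S" for u
    by (rule diff_chain_at[OF C_k_on_deriv[OF Suc.prems(2) that] C_k_on_deriv[OF Suc.prems(1)]])
      (use Suc.prems(3) that in auto)
  have partials: "C_k_on k (\<lambda>u. \<Sum>b\<in>Basis. (?h' u v \<bullet> b) *\<^sub>R ?f' (h u) b) S" for v
  proof (intro C_k_on_sum C_k_on_scaleR assms(1))
    fix b :: 'm
    show "C_k_on k (\<lambda>u. ?h' u v \<bullet> b) S"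
      using Suc.prems(2) by (intro C_k_on_linear[OF assms(1) bounded_linear_inner_left]) auto
    have "C_k_on k (\<lambda>y. ?f' y b) T"
      using Suc.prems(1) by simp
    from Suc.IH[OF this C_k_on_SucD[OF Suc.prems(2)] Suc.prems(3)]
    show "C_k_on k (\<lambda>u. ?f' (h u) b) S"
      by (simp only: o_def)
  qed simp
  have "(?f' (h u) \<circ> ?h' u) v = (\<Sum>b\<in>Basis. (?h' u v \<bullet> b) *\<^sub>R ?f' (h u) b)" if "u \<in> S" for u v
  proof -
    have "linear (?f' (h u))"
      using C_k_on_deriv[OF Suc.prems(1), of "h u"] Suc.prems(3) that has_derivative_linear by blast
    then show ?thesis
      by (simp add: linear_Basis_sum[of "?f' (h u)" "?h' u v"])
  qed
  then have "C_k_on k (\<lambda>u. (?f' (h u) \<circ> ?h' u) v) S" for v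
    by (intro C_k_on_cong[OF assms(1) _ partials[of v]]) auto
  with deriv show ?case
    using C_k_on_SucI[OF assms(1), of "f \<circ> h" "\<lambda>u. ?f' (h u) \<circ> ?h' u"] by blast
qed

lemma smooth_on_differentiable: "smooth_on f S \<Longrightarrow> u \<in> S \<Longrightarrow> f differentiable (at u)"
  unfolding smooth_on_def using C_k_on.simps(2) by blast

lemma smooth_on_frechet_derivative:
  "smooth_on f S \<Longrightarrow> smooth_on (\<lambda>u. frechet_derivative f (at u) v) S"
  unfolding smooth_on_def using C_k_on.simps(2) by blast

lemma smooth_on_cong: "open S \<Longrightarrow> (\<And>u. u \<in> S \<Longrightarrow> f u = h u) \<Longrightarrow> smooth_on f S \<Longrightarrow> smooth_on h S"
  unfolding smooth_on_def using C_k_on_cong by blast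

lemma smooth_on_subset: "smooth_on f S \<Longrightarrow> T \<subseteq> S \<Longrightarrow> smooth_on f T"
  unfolding smooth_on_def using C_k_on_subset by blast

lemma smooth_on_locally:
  assumes "\<And>u. u \<in> S \<Longrightarrow> \<exists>T. open T \<and> u \<in> T \<and> T \<subseteq> S \<and> smooth_on f T"
  shows "smooth_on f S"
proof -
  define \<S> where "\<S> = {T. open T \<and> T \<subseteq> S \<and> smooth_on f T}"
  have "S = \<Union>\<S>"
    using assms unfolding \<S>_def by blast
  then show ?thesis
    unfolding smooth_on_def
    using C_k_on_Union[of \<S> _ f] by (auto simp: \<S>_def smooth_on_def)
qed

lemma smooth_on_compose:
  fixes h :: "'k::euclidean_space \<Rightarrow> 'm::euclidean_space"
  shows "open S \<Longrightarrow> h ` S \<subseteq> T \<Longrightarrow> smooth_on f T \<Longrightarrow> smooth_on h S \<Longrightarrow> smooth_on (f \<circ> h) S"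
  unfolding smooth_on_def using C_k_on_compose by blast

lemma smooth_on_linear:
  assumes "open S" "bounded_linear L"
  shows "smooth_on L S"
proof -
  have "C_k_on k L S" for k
  proof (cases k)
    case 0
    then show ?thesis
      using assms(2) by (simp add: linear_continuous_on)
  next
    case (Suc k)
    then show ?thesis
      using C_k_on_SucI[OF assms(1), of L "\<lambda>_. L"] bounded_linear_imp_has_derivative[OF assms(2)]
        C_k_on_const[OF assms(1)] by blast
  qed
  then show ?thesis
    by (simp add: smooth_on_def)
qed

section \<open>Charts and smooth functions\<close>

lemma chart_dom_open: "is_chart c \<Longrightarrow> open (dom_chart c)"
  by (simp add: is_chart_def)

lemma param_coords: "is_chart c \<Longrightarrow> x \<in> dom_chart c \<Longrightarrow> param c (coords c x) = x"
  unfolding is_chart_def by (blast intro: homeomorphism_apply1)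

lemma chart_image_open:
  assumes "is_chart c" "open W"
  shows "open (coords c ` (dom_chart c \<inter> W))"
proof -
  have "openin (top_of_set (coords c ` dom_chart c)) (coords c ` (dom_chart c \<inter> W))"
    using assms unfolding is_chart_def by (blast intro: homeomorphism_imp_open_map openin_open_Int)
  then show ?thesis
    using assms(1) unfolding is_chart_def by (blast intro: openin_open_trans)
qed

context smooth_manifold
begin

text \<open>Foliated charts need not belong to \<open>\<A>\<close>; smooth functions and tangent vectors may be computed
  in any chart that could be added to the atlas.\<close>

definition compatible :: "('a, 'm) chart \<Rightarrow> bool" where
  "compatible c \<longleftrightarrow> smooth_atlas (insert c \<A>)"

lemma compatible_atlas: "c \<in> \<A> \<Longrightarrow> compatible c"
  using smooth_atlas by (simp add: compatible_def insert_absorb)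

lemma compatible_chart: "compatible c \<Longrightarrow> is_chart c"
  by (simp add: compatible_def smooth_atlas_def)

lemma compatible_transition:
  assumes "compatible c" "d \<in> \<A>"
  shows "smooth_on (coords d \<circ> param c) (coords c ` (dom_chart c \<inter> dom_chart d))"
    and "smooth_on (coords c \<circ> param d) (coords d ` (dom_chart d \<inter> dom_chart c))"
  using assms unfolding compatible_def smooth_atlas_def by blast+

lemma atlas_chart_at: obtains d where "d \<in> \<A>" "x \<in> dom_chart d"
  using smooth_atlas unfolding smooth_atlas_def by (metis UNIV_I UN_E)

lemma smooth_fun_open: "smooth_fun W f \<Longrightarrow> open W"
  by (simp add: smooth_fun_def)

text \<open>Near each point, \<open>f\<close> in the chart \<open>c\<close> is \<open>f\<close> in some chart of \<open>\<A>\<close> after a smooth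
  transition map.\<close>

lemma smooth_fun_chart:
  assumes "compatible c" "smooth_fun W f"
  shows "smooth_on (f \<circ> param c) (coords c ` (dom_chart c \<inter> W))"
proof (rule smooth_on_locally)
  fix u assume "u \<in> coords c ` (dom_chart c \<inter> W)"
  then obtain x where x: "x \<in> dom_chart c" "x \<in> W" "u = coords c x"
    by blast
  obtain d where d: "d \<in> \<A>" "x \<in> dom_chart d"
    by (rule atlas_chart_at)
  let ?T = "coords c ` (dom_chart c \<inter> (dom_chart d \<inter> W))"
  have charts: "is_chart c" "is_chart d"
    using assms(1) d(1) compatible_chart compatible_atlas by blast+
  have "open ?T"
    using charts smooth_fun_open[OF assms(2)] by (intro chart_image_open open_Int chart_dom_open)
  moreover have "smooth_on (f \<circ> param c) ?T"
  proof (rule smooth_on_cong[OF \<open>open ?T\<close>])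
    show "smooth_on ((f \<circ> param d) \<circ> (coords d \<circ> param c)) ?T"
    proof (rule smooth_on_compose[OF \<open>open ?T\<close>, where T = "coords d ` (dom_chart d \<inter> W)"])
      show "(coords d \<circ> param c) ` ?T \<subseteq> coords d ` (dom_chart d \<inter> W)"
        using charts by (auto simp: param_coords)
      show "smooth_on (f \<circ> param d) (coords d ` (dom_chart d \<inter> W))"
        using assms(2) d(1) by (simp add: smooth_fun_def)
      show "smooth_on (coords d \<circ> param c) ?T"
        using compatible_transition(1)[OF assms(1) d(1)] by (rule smooth_on_subset) blast
    qed
  qed (use charts in \<open>auto simp: param_coords\<close>)
  ultimately show "\<exists>T. open T \<and> u \<in> T \<and> T \<subseteq> coords c ` (dom_chart c \<inter> W) \<and>
      smooth_on (f \<circ> param c) T"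
    using x d(2) by (intro exI[of _ ?T]) auto
qed

lemma smooth_fun_coords:
  assumes "compatible c" "open W" "W \<subseteq> dom_chart c" "smooth_on h (coords c ` W)"
  shows "smooth_fun W (\<lambda>x. h (coords c x))"
  unfolding smooth_fun_def
proof (intro conjI ballI assms(2))
  fix d assume d: "d \<in> \<A>"
  let ?T = "coords d ` (dom_chart d \<inter> W)"
  have chart: "is_chart d"
    using d compatible_chart compatible_atlas by blast
  have "smooth_on (h \<circ> (coords c \<circ> param d)) ?T"
  proof (rule smooth_on_compose[OF chart_image_open[OF chart assms(2)] _ assms(4)])
    show "(coords c \<circ> param d) ` ?T \<subseteq> coords c ` W"
      using chart by (auto simp: param_coords)
    show "smooth_on (coords c \<circ> param d) ?T"
      using compatible_transition(2)[OF assms(1) d] by (rule smooth_on_subset) (use assms(3) in blast)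
  qed
  then show "smooth_on ((\<lambda>x. h (coords c x)) \<circ> param d) ?T"
    by (simp add: o_def)
qed

lemma smooth_fun_coordinate:
  assumes "compatible c" "open W" "W \<subseteq> dom_chart c"
  shows "smooth_fun W (\<lambda>x. coords c x \<bullet> b)"
proof (rule smooth_fun_coords[OF assms, of "\<lambda>u. u \<bullet> b"])
  have "open (coords c ` (dom_chart c \<inter> W))"
    using assms by (intro chart_image_open compatible_chart)
  moreover have "dom_chart c \<inter> W = W"
    using assms(3) by blast
  ultimately show "smooth_on (\<lambda>u. u \<bullet> b) (coords c ` W)"
    by (auto intro!: smooth_on_linear bounded_linear_inner_left)
qed

lemma atlas_image_open: "c \<in> \<A> \<Longrightarrow> open W \<Longrightarrow> open (coords c ` (dom_chart c \<inter> W))"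
  by (intro chart_image_open compatible_chart compatible_atlas)

lemma smooth_fun_subset: "smooth_fun W f \<Longrightarrow> open N \<Longrightarrow> N \<subseteq> W \<Longrightarrow> smooth_fun N f"
  unfolding smooth_fun_def by (auto intro: smooth_on_subset)

lemma smooth_fun_cong:
  assumes "\<And>x. x \<in> W \<Longrightarrow> f x = h x" "smooth_fun W f"
  shows "smooth_fun W h"
  unfolding smooth_fun_def
proof (intro conjI ballI)
  fix c assume c: "c \<in> \<A>"
  show "smooth_on (h \<circ> param c) (coords c ` (dom_chart c \<inter> W))"
    by (rule smooth_on_cong[of _ "f \<circ> param c"])
      (use assms c in \<open>auto simp: smooth_fun_def atlas_image_open param_coords
        compatible_chart compatible_atlas\<close>)
qed (use assms(2) in \<open>simp add: smooth_fun_def\<close>)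

lemma smooth_fun_locally:
  assumes "\<And>x. x \<in> W \<Longrightarrow> \<exists>N. x \<in> N \<and> N \<subseteq> W \<and> smooth_fun N f"
  shows "smooth_fun W f"
  unfolding smooth_fun_def
proof (intro conjI ballI)
  show "open W"
    using assms smooth_fun_open by (subst open_subopen) meson
  fix c assume c: "c \<in> \<A>"
  show "smooth_on (f \<circ> param c) (coords c ` (dom_chart c \<inter> W))"
  proof (rule smooth_on_locally)
    fix u assume "u \<in> coords c ` (dom_chart c \<inter> W)"
    then obtain x where x: "x \<in> dom_chart c" "x \<in> W" "u = coords c x"
      by blast
    obtain N where N: "x \<in> N" "N \<subseteq> W" "smooth_fun N f"
      using assms[OF x(2)] by blast
    show "\<exists>T. open T \<and> u \<in> T \<and> T \<subseteq> coords c ` (dom_chart c \<inter> W) \<and> smooth_on (f \<circ> param c) T"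
      using x N c atlas_image_open[OF c smooth_fun_open[OF N(3)]]
      by (intro exI[of _ "coords c ` (dom_chart c \<inter> N)"]) (auto simp: smooth_fun_def)
  qed
qed

lemma smooth_fun_const: "open W \<Longrightarrow> smooth_fun W (\<lambda>_. r)"
  by (simp add: smooth_fun_def smooth_on_def o_def C_k_on_const atlas_image_open)

lemma smooth_fun_add: "smooth_fun W f \<Longrightarrow> smooth_fun W h \<Longrightarrow> smooth_fun W (\<lambda>x. f x + h x)"
  by (simp add: smooth_fun_def smooth_on_def o_def C_k_on_add atlas_image_open)

lemma smooth_fun_mult:
  assumes "smooth_fun W f" "smooth_fun W h"
  shows "smooth_fun W (\<lambda>x. f x * h x)"
  using assms C_k_on_scaleR[OF atlas_image_open, of _ W _ "f \<circ> param _" "h \<circ> param _"]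
  by (simp add: smooth_fun_def smooth_on_def o_def)

lemma smooth_fun_diff:
  assumes "smooth_fun W f" "smooth_fun W h"
  shows "smooth_fun W (\<lambda>x. f x - h x)"
  using smooth_fun_add[OF assms(1) smooth_fun_mult[OF smooth_fun_const[of W "-1"] assms(2)]]
    smooth_fun_open[OF assms(1)] by simp

lemma smooth_fun_divide:
  assumes "smooth_fun W f" "smooth_fun W h" "\<And>x. x \<in> W \<Longrightarrow> h x \<noteq> 0"
  shows "smooth_fun W (\<lambda>x. f x / h x)"
proof -
  have "smooth_fun W (\<lambda>x. inverse (h x))"
    unfolding smooth_fun_def smooth_on_def
  proof (intro conjI ballI allI)
    fix c k assume c: "c \<in> \<A>"
    have "h (param c u) \<noteq> 0" if "u \<in> coords c ` (dom_chart c \<inter> W)" for u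
      using that assms(3) c by (auto simp: param_coords compatible_chart compatible_atlas)
    then show "C_k_on k ((\<lambda>x. inverse (h x)) \<circ> param c) (coords c ` (dom_chart c \<inter> W))"
      using assms(2) c unfolding o_def
      by (intro C_k_on_inverse atlas_image_open) (auto simp: smooth_fun_def smooth_on_def o_def)
  qed (use assms(2) in \<open>simp add: smooth_fun_def\<close>)
  then show ?thesis
    using smooth_fun_mult[OF assms(1)] by (simp add: field_class.field_divide_inverse)
qed

lemma smooth_atI: "smooth_fun W f \<Longrightarrow> x \<in> W \<Longrightarrow> smooth_at x f"
  unfolding smooth_at_def by blast

lemma smooth_at_coordinate:
  "compatible c \<Longrightarrow> x \<in> dom_chart c \<Longrightarrow> smooth_at x (\<lambda>y. coords c y \<bullet> b)"
  by (blast intro: smooth_atI smooth_fun_coordinate chart_dom_open compatible_chart)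

lemma smooth_at_cong:
  assumes "open N" "x \<in> N" "\<And>y. y \<in> N \<Longrightarrow> f y = h y" "smooth_at x f"
  shows "smooth_at x h"
proof -
  obtain W where W: "x \<in> W" "smooth_fun W f"
    using assms(4) by (auto simp: smooth_at_def)
  then have "smooth_fun (W \<inter> N) f"
    using assms(1) smooth_fun_open by (intro smooth_fun_subset[OF W(2)]) auto
  then have "smooth_fun (W \<inter> N) h"
    by (rule smooth_fun_cong[rotated]) (use assms(3) in auto)
  then show ?thesis
    using W assms(2) by (auto simp: smooth_at_def)
qed

lemma smooth_at_pair:
  assumes "smooth_at x f" "smooth_at x h"
  obtains W where "x \<in> W" "smooth_fun W f" "smooth_fun W h"
proof -
  obtain W W' where *: "x \<in> W" "smooth_fun W f" "x \<in> W'" "smooth_fun W' h"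
    using assms by (auto simp: smooth_at_def)
  have o: "open (W \<inter> W')"
    using * by (auto simp: smooth_fun_def)
  show thesis
    by (rule that[of "W \<inter> W'"])
      (use * in \<open>auto intro: smooth_fun_subset[OF _ o]\<close>)
qed

lemma smooth_at_add: "smooth_at x f \<Longrightarrow> smooth_at x h \<Longrightarrow> smooth_at x (\<lambda>y. f y + h y)"
  by (erule (1) smooth_at_pair) (blast intro: smooth_atI smooth_fun_add)

lemma smooth_at_mult: "smooth_at x f \<Longrightarrow> smooth_at x h \<Longrightarrow> smooth_at x (\<lambda>y. f y * h y)"
  by (erule (1) smooth_at_pair) (blast intro: smooth_atI smooth_fun_mult)

lemma smooth_at_const: "smooth_at x (\<lambda>_. r)"
  by (rule smooth_atI[of UNIV]) (auto intro: smooth_fun_const)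

section \<open>Tangent vectors\<close>

lemma coord_vector_has_derivative:
  assumes "compatible c" "x \<in> dom_chart c" "smooth_at x f"
  shows "((f \<circ> param c) has_derivative (\<lambda>\<xi>. coord_vector c x \<xi> f)) (at (coords c x))"
proof -
  obtain W where W: "x \<in> W" "smooth_fun W f"
    using assms(3) by (auto simp: smooth_at_def)
  have "(f \<circ> param c) differentiable (at (coords c x))"
    using smooth_fun_chart[OF assms(1) W(2)] W(1) assms(2) by (blast intro: smooth_on_differentiable)
  then show ?thesis
    using assms(3) by (simp add: coord_vector_def frechet_derivative_works)
qed

lemma coord_vector_eqI:
  assumes "compatible c" "x \<in> dom_chart c" "smooth_at x f"
    and "((f \<circ> param c) has_derivative L) (at (coords c x))"
  shows "coord_vector c x \<xi> f = L \<xi>"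
  using has_derivative_unique[OF coord_vector_has_derivative[OF assms(1-3)] assms(4)]
  by (simp add: fun_eq_iff)

lemma coord_vector_coordinate:
  assumes "compatible c" "x \<in> dom_chart c"
  shows "coord_vector c x \<xi> (\<lambda>y. coords c y \<bullet> b) = \<xi> \<bullet> b"
proof (rule coord_vector_eqI[OF assms smooth_at_coordinate[OF assms]])
  have "((\<lambda>u. u \<bullet> b) has_derivative (\<lambda>\<xi>. \<xi> \<bullet> b)) (at (coords c x))"
    by (intro bounded_linear_imp_has_derivative bounded_linear_inner_left)
  then show "((\<lambda>y. coords c y \<bullet> b) \<circ> param c has_derivative (\<lambda>\<xi>. \<xi> \<bullet> b)) (at (coords c x))"
  proof (rule has_derivative_transform_within_open)
    show "open (coords c ` (dom_chart c \<inter> UNIV))" "coords c x \<in> coords c ` (dom_chart c \<inter> UNIV)"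
      using chart_image_open[OF compatible_chart[OF assms(1)] open_UNIV] assms(2) by auto
  qed (use assms in \<open>auto simp: param_coords compatible_chart\<close>)
qed

lemma coord_vector_cong:
  assumes "compatible c" "x \<in> dom_chart c" "open N" "x \<in> N" "\<And>y. y \<in> N \<Longrightarrow> f y = h y"
  shows "coord_vector c x \<xi> f = coord_vector c x \<xi> h"
proof (cases "smooth_at x f")
  case True
  have "((f \<circ> param c) has_derivative (\<lambda>\<xi>. coord_vector c x \<xi> f)) (at (coords c x))"
    by (rule coord_vector_has_derivative[OF assms(1,2) True])
  then have "((h \<circ> param c) has_derivative (\<lambda>\<xi>. coord_vector c x \<xi> f)) (at (coords c x))"
  proof (rule has_derivative_transform_within_open)
    show "open (coords c ` (dom_chart c \<inter> N))"
      using assms by (intro chart_image_open compatible_chart)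
  qed (use assms in \<open>auto simp: param_coords compatible_chart\<close>)
  from coord_vector_eqI[OF assms(1,2) smooth_at_cong[OF assms(3-5) True] this]
  show ?thesis by simp
next
  case False
  then have "\<not> smooth_at x h"
    using smooth_at_cong[of N x h f] assms by auto
  with False show ?thesis
    by (simp add: coord_vector_def)
qed

text \<open>The chain rule for \<open>f \<circ> param c = (f \<circ> param d) \<circ> (coords d \<circ> param c)\<close>.\<close>

lemma coord_vector_change:
  assumes "compatible c" "compatible d" "x \<in> dom_chart c" "x \<in> dom_chart d"
    and L: "((coords d \<circ> param c) has_derivative L) (at (coords c x))"
  shows "coord_vector c x \<xi> = coord_vector d x (L \<xi>)"
proof
  fix f
  show "coord_vector c x \<xi> f = coord_vector d x (L \<xi>) f"
  proof (cases "smooth_at x f")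
    case True
    have charts: "is_chart c" "is_chart d"
      using assms compatible_chart by blast+
    have "((f \<circ> param d) \<circ> (coords d \<circ> param c) has_derivative
        (\<lambda>\<eta>. coord_vector d x \<eta> f) \<circ> L) (at (coords c x))"
      using coord_vector_has_derivative[OF assms(2,4) True] assms(3) charts
      by (intro diff_chain_at L) (simp add: param_coords)
    then have "((f \<circ> param c) has_derivative (\<lambda>\<eta>. coord_vector d x \<eta> f) \<circ> L) (at (coords c x))"
    proof (rule has_derivative_transform_within_open)
      show "open (coords c ` (dom_chart c \<inter> dom_chart d))"
        using charts by (intro chart_image_open chart_dom_open)
    qed (use assms charts in \<open>auto simp: param_coords\<close>)
    from coord_vector_eqI[OF assms(1,3) True this] show ?thesis
      by simp
  qed (simp add: coord_vector_def)
qed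

lemma transition_has_derivative:
  assumes "compatible c" "d \<in> \<A>" "x \<in> dom_chart c" "x \<in> dom_chart d"
  obtains L L' where "((coords d \<circ> param c) has_derivative L) (at (coords c x))"
    "((coords c \<circ> param d) has_derivative L') (at (coords d x))"
proof -
  have "coords d \<circ> param c differentiable (at (coords c x))"
    "coords c \<circ> param d differentiable (at (coords d x))"
    using compatible_transition[OF assms(1,2)] assms(3,4) smooth_on_differentiable by blast+
  then show thesis
    using that by (auto simp: differentiable_def)
qed

lemma coord_vector_tangent:
  assumes "compatible c" "x \<in> dom_chart c"
  shows "coord_vector c x \<xi> \<in> tangent_space x"
proof -
  obtain d where d: "d \<in> \<A>" "x \<in> dom_chart d"
    by (rule atlas_chart_at)
  obtain L where "((coords d \<circ> param c) has_derivative L) (at (coords c x))"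
    by (rule transition_has_derivative[OF assms(1) d(1) assms(2) d(2)])
  from coord_vector_change[OF assms(1) compatible_atlas[OF d(1)] assms(2) d(2) this] d
  show ?thesis
    unfolding tangent_space_def by blast
qed

lemma tangent_coord_vector:
  assumes "v \<in> tangent_space x" "compatible c" "x \<in> dom_chart c"
  obtains \<xi> where "v = coord_vector c x \<xi>"
proof -
  obtain d \<eta> where d: "d \<in> \<A>" "x \<in> dom_chart d" "v = coord_vector d x \<eta>"
    using assms(1) by (auto simp: tangent_space_def)
  obtain L where "((coords c \<circ> param d) has_derivative L) (at (coords d x))"
    by (rule transition_has_derivative[OF assms(2) d(1) assms(3) d(2)])
  from coord_vector_change[OF compatible_atlas[OF d(1)] assms(2) d(2) assms(3) this] d(3)
  show thesis
    using that by blast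
qed

lemma tangent_cong:
  assumes "v \<in> tangent_space x" "open N" "x \<in> N" "\<And>y. y \<in> N \<Longrightarrow> f y = h y"
  shows "v f = v h"
proof -
  obtain d \<eta> where d: "d \<in> \<A>" "x \<in> dom_chart d" "v = coord_vector d x \<eta>"
    using assms(1) by (auto simp: tangent_space_def)
  show ?thesis
    unfolding d(3) by (rule coord_vector_cong[OF compatible_atlas[OF d(1)] d(2) assms(2-4)])
qed

lemma tangent_add:
  assumes "v \<in> tangent_space x" "smooth_at x f" "smooth_at x h"
  shows "v (\<lambda>y. f y + h y) = v f + v h"
proof -
  obtain d \<eta> where d: "d \<in> \<A>" "x \<in> dom_chart d" "v = coord_vector d x \<eta>"
    using assms(1) by (auto simp: tangent_space_def)
  note d' = compatible_atlas[OF d(1)] d(2)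
  have "((\<lambda>y. f y + h y) \<circ> param d has_derivative
      (\<lambda>\<xi>. coord_vector d x \<xi> f + coord_vector d x \<xi> h)) (at (coords d x))"
    using has_derivative_add[OF coord_vector_has_derivative[OF d' assms(2)]
        coord_vector_has_derivative[OF d' assms(3)]]
    by (simp add: o_def)
  from coord_vector_eqI[OF d' smooth_at_add[OF assms(2,3)] this] show ?thesis
    by (simp add: d(3))
qed

lemma tangent_mult:
  assumes "v \<in> tangent_space x" "smooth_at x f" "smooth_at x h"
  shows "v (\<lambda>y. f y * h y) = f x * v h + v f * h x"
proof -
  obtain d \<eta> where d: "d \<in> \<A>" "x \<in> dom_chart d" "v = coord_vector d x \<eta>"
    using assms(1) by (auto simp: tangent_space_def)
  note d' = compatible_atlas[OF d(1)] d(2)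
  have "((\<lambda>y. f y * h y) \<circ> param d has_derivative
      (\<lambda>\<xi>. f x * coord_vector d x \<xi> h + coord_vector d x \<xi> f * h x)) (at (coords d x))"
    using has_derivative_mult[OF coord_vector_has_derivative[OF d' assms(2)]
        coord_vector_has_derivative[OF d' assms(3)]] d'
    by (simp add: o_def param_coords compatible_chart)
  from coord_vector_eqI[OF d' smooth_at_mult[OF assms(2,3)] this] show ?thesis
    by (simp add: d(3))
qed

lemma tangent_const:
  assumes "v \<in> tangent_space x"
  shows "v (\<lambda>_. r) = 0"
proof -
  obtain d \<eta> where d: "d \<in> \<A>" "x \<in> dom_chart d" "v = coord_vector d x \<eta>"
    using assms(1) by (auto simp: tangent_space_def)
  note d' = compatible_atlas[OF d(1)] d(2)
  have "((\<lambda>_. r) \<circ> param d has_derivative (\<lambda>\<xi>. 0)) (at (coords d x))"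
    by (simp add: o_def)
  from coord_vector_eqI[OF d' smooth_at_const this] show ?thesis
    by (simp add: d(3))
qed

lemma tangent_cmult:
  "v \<in> tangent_space x \<Longrightarrow> smooth_at x f \<Longrightarrow> v (\<lambda>y. r * f y) = r * v f"
  using tangent_mult[OF _ smooth_at_const[of x r], of v f] tangent_const[of v x r] by simp

lemma tangent_diff:
  assumes "v \<in> tangent_space x" "smooth_at x f" "smooth_at x h"
  shows "v (\<lambda>y. f y - h y) = v f - v h"
  using tangent_add[OF assms(1,2) smooth_at_mult[OF smooth_at_const[of x "-1"] assms(3)]]
    tangent_cmult[OF assms(1,3), of "-1"]
  by simp

lemma coord_vector_lincomb:
  assumes "compatible c" "x \<in> dom_chart c"
  shows "scale r (coord_vector c x \<xi>) + coord_vector c x \<eta> = coord_vector c x (r *\<^sub>R \<xi> + \<eta>)"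
proof
  fix f
  show "(scale r (coord_vector c x \<xi>) + coord_vector c x \<eta>) f = coord_vector c x (r *\<^sub>R \<xi> + \<eta>) f"
  proof (cases "smooth_at x f")
    case True
    then have lin: "linear (\<lambda>\<xi>. coord_vector c x \<xi> f)"
      using coord_vector_has_derivative[OF assms] has_derivative_linear by blast
    show ?thesis
      using linear_add[OF lin, of "r *\<^sub>R \<xi>" \<eta>] linear_scale[OF lin, of r \<xi>]
      by (simp add: scale_def)
  qed (simp add: scale_def coord_vector_def)
qed

lemma tangent_lincomb:
  assumes "u \<in> tangent_space x" "v \<in> tangent_space x"
  shows "scale r u + v \<in> tangent_space x"
proof -
  obtain d where d: "d \<in> \<A>" "x \<in> dom_chart d"
    by (rule atlas_chart_at)
  note d' = compatible_atlas[OF d(1)] d(2)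
  obtain \<xi> \<eta> where "u = coord_vector d x \<xi>" "v = coord_vector d x \<eta>"
    using tangent_coord_vector[OF assms(1) d'] tangent_coord_vector[OF assms(2) d'] by metis
  then show ?thesis
    using coord_vector_lincomb[OF d'] coord_vector_tangent[OF d'] by simp
qed

lemma tangent_zero: "0 \<in> tangent_space x"
proof -
  obtain d where d: "d \<in> \<A>" "x \<in> dom_chart d"
    by (rule atlas_chart_at)
  have "coord_vector d x 0 = 0"
    using coord_vector_lincomb[OF compatible_atlas[OF d(1)] d(2), of "-1" 0 0]
    by (simp add: fun_eq_iff scale_def)
  then show ?thesis
    using coord_vector_tangent[OF compatible_atlas[OF d(1)] d(2), of 0] by simp
qed

lemma tangent_plus: "u \<in> tangent_space x \<Longrightarrow> v \<in> tangent_space x \<Longrightarrow> u + v \<in> tangent_space x"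
  using tangent_lincomb[of u x v 1] by (simp add: scale_def)

lemma tangent_scale: "u \<in> tangent_space x \<Longrightarrow> scale r u \<in> tangent_space x"
  using tangent_lincomb[OF _ tangent_zero, of u x r] by simp

lemma tangent_minus: "u \<in> tangent_space x \<Longrightarrow> v \<in> tangent_space x \<Longrightarrow> u - v \<in> tangent_space x"
  using tangent_lincomb[of v x u "-1"] by (simp add: scale_def plus_fun_def fun_diff_def)

section \<open>Vector fields and brackets\<close>

lemma vector_fields_open: "X \<in> vector_fields W \<Longrightarrow> open W"
  by (simp add: vector_fields_def)

lemma vector_fields_tangent: "X \<in> vector_fields W \<Longrightarrow> x \<in> W \<Longrightarrow> X x \<in> tangent_space x"
  by (simp add: vector_fields_def)

lemma vector_fields_smooth:
  "X \<in> vector_fields W \<Longrightarrow> smooth_fun N f \<Longrightarrow> N \<subseteq> W \<Longrightarrow> smooth_fun N (\<lambda>x. X x f)"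
  by (simp add: vector_fields_def)

lemma vector_fields_smooth_at:
  assumes "X \<in> vector_fields W" "x \<in> W" "smooth_at x f"
  shows "smooth_at x (\<lambda>y. X y f)"
proof -
  obtain N where N: "x \<in> N" "smooth_fun N f"
    using assms(3) by (auto simp: smooth_at_def)
  then have "smooth_fun (N \<inter> W) f"
    using assms(1) by (auto intro!: smooth_fun_subset[OF N(2)] dest: smooth_fun_open vector_fields_open)
  from vector_fields_smooth[OF assms(1) this] show ?thesis
    using N assms(2) by (auto intro: smooth_atI)
qed

lemma vector_fields_subset: "X \<in> vector_fields W \<Longrightarrow> open N \<Longrightarrow> N \<subseteq> W \<Longrightarrow> X \<in> vector_fields N"
  by (auto simp: vector_fields_def)

lemma vector_fields_cong:
  assumes "X \<in> vector_fields W" "\<And>x. x \<in> W \<Longrightarrow> X x = X' x"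
  shows "X' \<in> vector_fields W"
proof -
  have "smooth_fun N (\<lambda>x. X' x f)" if "N \<subseteq> W" "smooth_fun N f" for N f
    by (rule smooth_fun_cong[OF _ vector_fields_smooth[OF assms(1) that(2,1)]])
      (use assms(2) that in auto)
  then show ?thesis
    using assms by (simp add: vector_fields_def)
qed

lemma vector_fields_locally:
  assumes "\<And>x. x \<in> W \<Longrightarrow> \<exists>N. x \<in> N \<and> N \<subseteq> W \<and> X \<in> vector_fields N"
  shows "X \<in> vector_fields W"
  unfolding vector_fields_def
proof (intro CollectI conjI ballI allI impI)
  show "open W"
    using assms vector_fields_open by (subst open_subopen) meson
  show "X x \<in> tangent_space x" if "x \<in> W" for x
    using assms[OF that] vector_fields_tangent by blast
  fix W' f assume *: "W' \<subseteq> W" "smooth_fun W' f"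
  show "smooth_fun W' (\<lambda>x. X x f)"
  proof (rule smooth_fun_locally)
    fix x assume "x \<in> W'"
    with assms * obtain N where N: "x \<in> N" "X \<in> vector_fields N"
      by blast
    have "smooth_fun (N \<inter> W') f"
      using N * by (auto intro!: smooth_fun_subset[OF *(2)] dest: smooth_fun_open vector_fields_open)
    from vector_fields_smooth[OF N(2) this]
    show "\<exists>N. x \<in> N \<and> N \<subseteq> W' \<and> smooth_fun N (\<lambda>x. X x f)"
      using N \<open>x \<in> W'\<close> by (intro exI[of _ "N \<inter> W'"]) auto
  qed
qed

lemma vector_fields_plus:
  "X \<in> vector_fields W \<Longrightarrow> Y \<in> vector_fields W \<Longrightarrow> X + Y \<in> vector_fields W"
  by (simp add: vector_fields_def tangent_plus smooth_fun_add)

lemma vector_fields_minus: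
  "X \<in> vector_fields W \<Longrightarrow> Y \<in> vector_fields W \<Longrightarrow> X - Y \<in> vector_fields W"
  by (simp add: vector_fields_def tangent_minus smooth_fun_diff)

lemma vector_fields_zero: "open W \<Longrightarrow> 0 \<in> vector_fields W"
  by (auto simp: vector_fields_def tangent_zero intro!: smooth_fun_const dest: smooth_fun_open)

lemma vector_fields_fscale:
  assumes "smooth_fun W h" "X \<in> vector_fields W"
  shows "fscale h X \<in> vector_fields W"
proof -
  have "smooth_fun N (\<lambda>x. h x * X x f)" if "N \<subseteq> W" "smooth_fun N f" for N f
    using smooth_fun_mult[OF smooth_fun_subset[OF assms(1) smooth_fun_open[OF that(2)] that(1)]
        vector_fields_smooth[OF assms(2) that(2,1)]] .
  then have "smooth_fun N (\<lambda>x. fscale h X x f)" if "N \<subseteq> W" "smooth_fun N f" for N f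
    using that by (simp add: fscale_def scale_def)
  moreover have "fscale h X x \<in> tangent_space x" if "x \<in> W" for x
    using that assms by (simp add: fscale_def tangent_scale vector_fields_tangent)
  ultimately show ?thesis
    using assms by (simp add: vector_fields_def)
qed

lemma coord_field:
  assumes "compatible c" "open W" "W \<subseteq> dom_chart c"
  shows "(\<lambda>x. coord_vector c x \<xi>) \<in> vector_fields W"
  unfolding vector_fields_def
proof (intro CollectI conjI ballI allI impI assms(2))
  show "coord_vector c x \<xi> \<in> tangent_space x" if "x \<in> W" for x
    using that assms(3) by (intro coord_vector_tangent[OF assms(1)]) auto
  fix N f assume N: "N \<subseteq> W" "smooth_fun N f"
  have sub: "N \<subseteq> dom_chart c"
    using N assms by blast
  have "smooth_on (f \<circ> param c) (coords c ` N)"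
    using smooth_fun_chart[OF assms(1) N(2)] sub by (simp add: Int_absorb1)
  from smooth_fun_coords[OF assms(1) smooth_fun_open[OF N(2)] sub
      smooth_on_frechet_derivative[OF this]]
  show "smooth_fun N (\<lambda>x. coord_vector c x \<xi> f)"
    by (rule smooth_fun_cong[rotated]) (use N in \<open>auto simp: coord_vector_def intro: smooth_atI\<close>)
qed

lemma lie_bracket_apply:
  "smooth_at x f \<Longrightarrow> lie_bracket X Y x f = X x (\<lambda>y. Y y f) - Y x (\<lambda>y. X y f)"
  by (simp add: lie_bracket_def)

lemma apply_lie_bracket:
  assumes "v \<in> tangent_space x" "Y \<in> vector_fields W" "Z \<in> vector_fields W" "x \<in> W" "smooth_at x f"
  shows "v (\<lambda>y. lie_bracket Y Z y f) = v (\<lambda>y. Y y (\<lambda>z. Z z f)) - v (\<lambda>y. Z y (\<lambda>z. Y z f))"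
proof -
  obtain N where N: "x \<in> N" "smooth_fun N f"
    using assms(5) by (auto simp: smooth_at_def)
  have "v (\<lambda>y. lie_bracket Y Z y f) = v (\<lambda>y. Y y (\<lambda>z. Z z f) - Z y (\<lambda>z. Y z f))"
    by (rule tangent_cong[OF assms(1) smooth_fun_open[OF N(2)] N(1)])
      (use N(2) in \<open>auto intro: lie_bracket_apply smooth_atI\<close>)
  also have "\<dots> = v (\<lambda>y. Y y (\<lambda>z. Z z f)) - v (\<lambda>y. Z y (\<lambda>z. Y z f))"
    by (rule tangent_diff[OF assms(1)
          vector_fields_smooth_at[OF assms(2,4) vector_fields_smooth_at[OF assms(3-5)]]
          vector_fields_smooth_at[OF assms(3,4) vector_fields_smooth_at[OF assms(2,4,5)]]])
  finally show ?thesis .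
qed

text \<open>On a smooth function, all terms are iterated derivatives of third order, and those of each of
  the six orders of \<open>X\<close>, \<open>Y\<close>, \<open>Z\<close> match.\<close>

lemma jacobi_identity:
  assumes "X \<in> vector_fields W" "Y \<in> vector_fields W" "Z \<in> vector_fields W" "x \<in> W"
  shows "lie_bracket (lie_bracket X Y) Z x
    = lie_bracket X (lie_bracket Y Z) x - lie_bracket Y (lie_bracket X Z) x"
proof
  fix f
  show "lie_bracket (lie_bracket X Y) Z x f
    = (lie_bracket X (lie_bracket Y Z) x - lie_bracket Y (lie_bracket X Z) x) f"
  proof (cases "smooth_at x f")
    case True
    note sm = True vector_fields_smooth_at[OF _ assms(4) True]
    note tan = vector_fields_tangent[OF _ assms(4)]
    show ?thesis
      by (simp add: lie_bracket_apply sm assms(1-3)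
          apply_lie_bracket[OF tan[OF assms(1)] assms(2,3,4) True]
          apply_lie_bracket[OF tan[OF assms(2)] assms(1,3,4) True]
          apply_lie_bracket[OF tan[OF assms(3)] assms(1,2,4) True])
  qed (simp add: lie_bracket_def)
qed

end

section \<open>Riemannian metrics and the Levi-Civita connection\<close>

locale riemannian_manifold = smooth_manifold \<A>
  for \<A> :: "('a::{t2_space, second_countable_topology}, 'm::euclidean_space) chart set" +
  fixes g :: "'a \<Rightarrow> 'a tangent \<Rightarrow> 'a tangent \<Rightarrow> real"
    and D :: "'a vfield \<Rightarrow> 'a vfield \<Rightarrow> 'a vfield"
  assumes riemannian: "riemannian_metric g"
    and levi_civita_connection: "levi_civita g D"
begin

lemma g_sym: "u \<in> tangent_space x \<Longrightarrow> v \<in> tangent_space x \<Longrightarrow> g x u v = g x v u"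
  by (rule riemannian[unfolded riemannian_metric_def, THEN conjunct1, rule_format])

lemma g_lincomb:
  "u \<in> tangent_space x \<Longrightarrow> v \<in> tangent_space x \<Longrightarrow> w \<in> tangent_space x \<Longrightarrow>
    g x (scale r u + v) w = r * g x u w + g x v w"
  by (rule riemannian[unfolded riemannian_metric_def, THEN conjunct2, THEN conjunct1, rule_format])

lemma g_pos: "v \<in> tangent_space x \<Longrightarrow> v \<noteq> 0 \<Longrightarrow> g x v v > 0"
  by (rule riemannian[unfolded riemannian_metric_def, THEN conjunct2, THEN conjunct2, THEN conjunct1, rule_format])

lemma g_smooth:
  "X \<in> vector_fields W \<Longrightarrow> Y \<in> vector_fields W \<Longrightarrow> smooth_fun W (\<lambda>x. g x (X x) (Y x))"
  by (rule riemannian[unfolded riemannian_metric_def, THEN conjunct2, THEN conjunct2, THEN conjunct2, rule_format])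

lemma g_plus_left:
  "u \<in> tangent_space x \<Longrightarrow> v \<in> tangent_space x \<Longrightarrow> w \<in> tangent_space x \<Longrightarrow>
    g x (u + v) w = g x u w + g x v w"
  using g_lincomb[of u x v w 1] by (simp add: scale_def)

lemma g_zero_left: "w \<in> tangent_space x \<Longrightarrow> g x 0 w = 0"
  using g_plus_left[OF tangent_zero tangent_zero, of w x] by simp

lemma g_scale_left:
  "u \<in> tangent_space x \<Longrightarrow> w \<in> tangent_space x \<Longrightarrow> g x (scale r u) w = r * g x u w"
  using g_lincomb[OF _ tangent_zero, of u x w r] g_zero_left[of w x] by simp

lemma g_minus_left:
  "u \<in> tangent_space x \<Longrightarrow> v \<in> tangent_space x \<Longrightarrow> w \<in> tangent_space x \<Longrightarrow>
    g x (u - v) w = g x u w - g x v w"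
  using g_plus_left[of "u - v" x v w] by (simp add: tangent_minus)

lemma g_plus_right:
  "u \<in> tangent_space x \<Longrightarrow> v \<in> tangent_space x \<Longrightarrow> w \<in> tangent_space x \<Longrightarrow>
    g x w (u + v) = g x w u + g x w v"
  using g_plus_left[of u x v w] g_sym[of w x] by (simp add: tangent_plus)

lemma g_zero_right: "w \<in> tangent_space x \<Longrightarrow> g x w 0 = 0"
  using g_zero_left[of w x] g_sym[OF _ tangent_zero, of w x] by simp

lemma g_scale_right:
  "u \<in> tangent_space x \<Longrightarrow> w \<in> tangent_space x \<Longrightarrow> g x w (scale r u) = r * g x w u"
  using g_scale_left[of u x w r] g_sym[of w x u] g_sym[OF _ tangent_scale, of w x u r] by simp

lemma g_minus_right:
  "u \<in> tangent_space x \<Longrightarrow> v \<in> tangent_space x \<Longrightarrow> w \<in> tangent_space x \<Longrightarrow>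
    g x w (u - v) = g x w u - g x w v"
  using g_minus_left[of u x v w] g_sym[of w x] by (simp add: tangent_minus)

lemmas g_linear = g_plus_left g_minus_left g_scale_left g_plus_right g_minus_right g_scale_right

lemma connection_axioms: "affine_connection D"
  using levi_civita_connection by (simp add: levi_civita_def)

lemma connection_field:
  "X \<in> vector_fields W \<Longrightarrow> Y \<in> vector_fields W \<Longrightarrow> D X Y \<in> vector_fields W"
  by (rule connection_axioms[unfolded affine_connection_def, THEN conjunct1, rule_format])

lemma connection_tangent:
  "X \<in> vector_fields W \<Longrightarrow> Y \<in> vector_fields W \<Longrightarrow> x \<in> W \<Longrightarrow> D X Y x \<in> tangent_space x"
  by (rule vector_fields_tangent[OF connection_field])

lemma connection_plus_left:
  "X \<in> vector_fields W \<Longrightarrow> X' \<in> vector_fields W \<Longrightarrow> Y \<in> vector_fields W \<Longrightarrow> x \<in> W \<Longrightarrow>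
    D (X + X') Y x = D X Y x + D X' Y x"
  by (rule connection_axioms[unfolded affine_connection_def, THEN conjunct2, THEN conjunct1, rule_format])

lemma connection_plus_right:
  "X \<in> vector_fields W \<Longrightarrow> Y \<in> vector_fields W \<Longrightarrow> Y' \<in> vector_fields W \<Longrightarrow> x \<in> W \<Longrightarrow>
    D X (Y + Y') x = D X Y x + D X Y' x"
  by (rule connection_axioms[unfolded affine_connection_def, THEN conjunct2, THEN conjunct2,
        THEN conjunct2, THEN conjunct1, rule_format])

lemma connection_fscale_left:
  "X \<in> vector_fields W \<Longrightarrow> Y \<in> vector_fields W \<Longrightarrow> smooth_fun W f \<Longrightarrow> x \<in> W \<Longrightarrow>
    D (fscale f X) Y x = scale (f x) (D X Y x)"
  by (rule connection_axioms[unfolded affine_connection_def, THEN conjunct2, THEN conjunct2,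
        THEN conjunct1, rule_format])

lemma connection_fscale_right:
  "X \<in> vector_fields W \<Longrightarrow> Y \<in> vector_fields W \<Longrightarrow> smooth_fun W f \<Longrightarrow> x \<in> W \<Longrightarrow>
    D X (fscale f Y) x = scale (X x f) (Y x) + scale (f x) (D X Y x)"
  by (rule connection_axioms[unfolded affine_connection_def, THEN conjunct2, THEN conjunct2,
        THEN conjunct2, THEN conjunct2, rule_format])

text \<open>If \<open>Z\<close> vanishes on \<open>W\<close>, then \<open>Z = f Z\<close> everywhere for the function \<open>f\<close> that is \<open>0\<close> on \<open>W\<close> and
  \<open>1\<close> elsewhere. This \<open>f\<close> is smooth on \<open>W\<close>, so linearity over functions and the Leibniz rule make
  the derivatives of \<open>Z\<close> and along \<open>Z\<close> vanish on \<open>W\<close>.\<close>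

lemma connection_vanishing:
  assumes "Z \<in> vector_fields W" "\<And>y. y \<in> W \<Longrightarrow> Z y = 0" "Y \<in> vector_fields W" "x \<in> W"
  shows "D Z Y x = 0" "D Y Z x = 0"
proof -
  define f :: "'a \<Rightarrow> real" where "f y = (if y \<in> W then 0 else 1)" for y
  have f: "smooth_fun W f"
    by (rule smooth_fun_cong[OF _ smooth_fun_const[of W 0]])
      (use assms(1) in \<open>auto simp: f_def vector_fields_open\<close>)
  have Z: "fscale f Z = Z"
    using assms(2) by (auto simp: fscale_def scale_def f_def fun_eq_iff)
  have "D (fscale f Z) Y x = scale (f x) (D Z Y x)"
    by (rule connection_fscale_left[OF assms(1,3) f assms(4)])
  then show "D Z Y x = 0"
    using assms(4) by (simp add: Z f_def scale_def fun_eq_iff)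
  have "D Y (fscale f Z) x = scale (Y x f) (Z x) + scale (f x) (D Y Z x)"
    by (rule connection_fscale_right[OF assms(3,1) f assms(4)])
  then show "D Y Z x = 0"
    using assms(2,4) by (simp add: Z f_def scale_def fun_eq_iff)
qed

lemma connection_cong:
  assumes "X \<in> vector_fields W" "Y \<in> vector_fields W"
    and "\<And>y. y \<in> W \<Longrightarrow> X y = X' y" "\<And>y. y \<in> W \<Longrightarrow> Y y = Y' y" "x \<in> W"
  shows "D X Y x = D X' Y' x"
proof -
  have fields: "X' \<in> vector_fields W" "Y' \<in> vector_fields W"
    using vector_fields_cong assms by blast+
  have "D X Y x = D (X' + (X - X')) Y x"
    by simp
  also have "\<dots> = D X' Y x"
    using connection_plus_left[OF fields(1) vector_fields_minus[OF assms(1) fields(1)] assms(2,5)]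
      connection_vanishing(1)[OF vector_fields_minus[OF assms(1) fields(1)] _ assms(2,5)] assms(3)
    by simp
  also have "\<dots> = D X' (Y' + (Y - Y')) x"
    by simp
  also have "\<dots> = D X' Y' x"
    using connection_plus_right[OF fields vector_fields_minus[OF assms(2) fields(2)] assms(5)]
      connection_vanishing(2)[OF vector_fields_minus[OF assms(2) fields(2)] _ fields(1) assms(5)]
      assms(4)
    by simp
  finally show ?thesis .
qed

lemma lie_bracket_connection:
  "X \<in> vector_fields W \<Longrightarrow> Y \<in> vector_fields W \<Longrightarrow> x \<in> W \<Longrightarrow>
    lie_bracket X Y x = D X Y x - D Y X x"
  by (rule levi_civita_connection[unfolded levi_civita_def, THEN conjunct2, THEN conjunct1,
        rule_format, symmetric])

text \<open>The bracket, a difference of second-order operators, is a field of tangent vectors because it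
  equals \<open>D\<^sub>X Y - D\<^sub>Y X\<close>.\<close>

lemma lie_bracket_field:
  assumes "X \<in> vector_fields W" "Y \<in> vector_fields W"
  shows "lie_bracket X Y \<in> vector_fields W"
  by (rule vector_fields_cong[OF
        vector_fields_minus[OF connection_field[OF assms] connection_field[OF assms(2,1)]]])
    (simp add: lie_bracket_connection[OF assms])

lemma connection_metric:
  "X \<in> vector_fields W \<Longrightarrow> Y \<in> vector_fields W \<Longrightarrow> Z \<in> vector_fields W \<Longrightarrow> x \<in> W \<Longrightarrow>
    X x (\<lambda>y. g y (Y y) (Z y)) = g x (D X Y x) (Z x) + g x (Y x) (D X Z x)"
  by (rule levi_civita_connection[unfolded levi_civita_def, THEN conjunct2, THEN conjunct2,
        rule_format])

text \<open>The Lie derivative of the metric along \<open>Z\<close>, evaluated on \<open>U\<close> and \<open>V\<close>. A vertical field is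
  Killing along the leaves when this vanishes for all vertical \<open>U\<close> and \<open>V\<close>.\<close>

definition metric_lie :: "'a vfield \<Rightarrow> 'a vfield \<Rightarrow> 'a vfield \<Rightarrow> 'a \<Rightarrow> real" where
  "metric_lie Z U V x = g x (D U Z x) (V x) + g x (U x) (D V Z x)"

lemma metric_lie_derivative:
  assumes "Z \<in> vector_fields W" "U \<in> vector_fields W" "V \<in> vector_fields W" "x \<in> W"
  shows "Z x (\<lambda>y. g y (U y) (V y)) =
    g x (lie_bracket Z U x) (V x) + g x (U x) (lie_bracket Z V x) + metric_lie Z U V x"
proof -
  note t = connection_tangent[OF _ _ assms(4)] vector_fields_tangent[OF _ assms(4)] assms(1-3)
  show ?thesis
    by (simp add: connection_metric[OF assms] metric_lie_def g_linear t
        lie_bracket_connection[OF assms(1,2,4)] lie_bracket_connection[OF assms(1,3,4)])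
qed

lemma metric_lie_plus:
  assumes "Z \<in> vector_fields W" "Z' \<in> vector_fields W" "U \<in> vector_fields W" "V \<in> vector_fields W"
    "x \<in> W"
  shows "metric_lie (Z + Z') U V x = metric_lie Z U V x + metric_lie Z' U V x"
proof -
  note t = connection_tangent[OF _ _ assms(5)] vector_fields_tangent[OF _ assms(5)] assms(1-4)
  show ?thesis
    by (simp add: metric_lie_def connection_plus_right[OF _ assms(1,2,5)] g_linear t)
qed

text \<open>The commutator rule \<open>L\<^bsub>[X,Y]\<^esub> = [L\<^sub>X, L\<^sub>Y]\<close> applied to the metric, restricted to a class \<open>\<V>\<close>
  of fields that is stable under bracketing with \<open>X\<close> and \<open>Y\<close>. If \<open>L\<^sub>X g = a g\<close> and \<open>L\<^sub>Y g = b g\<close> on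
  \<open>\<V>\<close>, the terms with \<open>a b\<close> and those with brackets cancel, the latter by the Jacobi identity.\<close>

lemma metric_lie_bracket_conformal:
  assumes X: "X \<in> vector_fields W" and Y: "Y \<in> vector_fields W" and V: "\<V> \<subseteq> vector_fields W"
    and stable: "\<And>U. U \<in> \<V> \<Longrightarrow> lie_bracket X U \<in> \<V>" "\<And>U. U \<in> \<V> \<Longrightarrow> lie_bracket Y U \<in> \<V>"
    and smooth: "smooth_fun W a" "smooth_fun W b"
    and conformal:
      "\<And>U V y. U \<in> \<V> \<Longrightarrow> V \<in> \<V> \<Longrightarrow> y \<in> W \<Longrightarrow> metric_lie X U V y = a y * g y (U y) (V y)"
      "\<And>U V y. U \<in> \<V> \<Longrightarrow> V \<in> \<V> \<Longrightarrow> y \<in> W \<Longrightarrow> metric_lie Y U V y = b y * g y (U y) (V y)"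
    and UV: "U \<in> \<V>" "V \<in> \<V>" and x: "x \<in> W"
  shows "metric_lie (lie_bracket X Y) U V x = (X x b - Y x a) * g x (U x) (V x)"
proof -
  let ?G = "\<lambda>U V y. g y (U y) (V y)"
  have first: "Z x (?G P Q) = ?G (lie_bracket Z P) Q x + ?G P (lie_bracket Z Q) x + h x * ?G P Q x"
    if "P \<in> \<V>" "Q \<in> \<V>" "Z = X \<and> h = a \<or> Z = Y \<and> h = b" "x \<in> W" for Z P Q h x
    using metric_lie_derivative[of Z W P Q x] that X Y subsetD[OF V that(1)] subsetD[OF V that(2)]
      conformal by auto
  have second: "Z x (\<lambda>y. Z' y (?G U V)) =
      Z x (?G (lie_bracket Z' U) V) + Z x (?G U (lie_bracket Z' V))
      + (h x * Z x (?G U V) + Z x h * ?G U V x)"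
    if Z': "Z' = X \<and> h = a \<or> Z' = Y \<and> h = b" and Z: "Z \<in> vector_fields W" for Z Z' h
  proof -
    have br: "lie_bracket Z' U \<in> \<V>" "lie_bracket Z' V \<in> \<V>"
      using Z' stable UV by auto
    have sm: "smooth_fun W (?G P Q)" if "P \<in> \<V>" "Q \<in> \<V>" for P Q
      using that V g_smooth by blast
    have "smooth_fun W h"
      using Z' smooth by auto
    note at = sm[OF br(1) UV(2), THEN smooth_atI, OF x] sm[OF UV(1) br(2), THEN smooth_atI, OF x]
      sm[OF UV, THEN smooth_atI, OF x] this[THEN smooth_atI, OF x]
    note v = vector_fields_tangent[OF Z x]
    have "Z x (\<lambda>y. Z' y (?G U V)) =
        Z x (\<lambda>y. (?G (lie_bracket Z' U) V y + ?G U (lie_bracket Z' V) y) + h y * ?G U V y)"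
      by (rule tangent_cong[OF vector_fields_tangent[OF Z x] vector_fields_open[OF Z] x])
        (use first[OF UV Z'] in auto)
    also have "\<dots> = Z x (?G (lie_bracket Z' U) V) + Z x (?G U (lie_bracket Z' V))
        + (h x * Z x (?G U V) + Z x h * ?G U V x)"
      by (simp only: tangent_add[OF v smooth_at_add[OF at(1,2)] smooth_at_mult[OF at(4,3)]]
          tangent_add[OF v at(1,2)] tangent_mult[OF v at(4,3)])
    finally show ?thesis .
  qed
  have XY: "X \<in> vector_fields W" "Y \<in> vector_fields W" "U \<in> vector_fields W" "V \<in> vector_fields W"
    using X Y UV V by auto
  note br = lie_bracket_field
  note t = vector_fields_tangent[OF _ x]
  have jac: "lie_bracket (lie_bracket X Y) P x
      = lie_bracket X (lie_bracket Y P) x - lie_bracket Y (lie_bracket X P) x" if "P \<in> \<V>" for P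
    using jacobi_identity[OF X Y _ x] that V by blast
  have fX: "X x (?G P Q) = ?G (lie_bracket X P) Q x + ?G P (lie_bracket X Q) x + a x * ?G P Q x"
    if "P \<in> \<V>" "Q \<in> \<V>" for P Q
    using first that x by blast
  have fY: "Y x (?G P Q) = ?G (lie_bracket Y P) Q x + ?G P (lie_bracket Y Q) x + b x * ?G P Q x"
    if "P \<in> \<V>" "Q \<in> \<V>" for P Q
    using first that x by blast
  have sXY: "X x (\<lambda>y. Y y (?G U V)) = X x (?G (lie_bracket Y U) V) + X x (?G U (lie_bracket Y V))
      + (b x * X x (?G U V) + X x b * ?G U V x)"
    using second X by blast
  have sYX: "Y x (\<lambda>y. X y (?G U V)) = Y x (?G (lie_bracket X U) V) + Y x (?G U (lie_bracket X V))
      + (a x * Y x (?G U V) + Y x a * ?G U V x)"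
    using second Y by blast
  have comm: "lie_bracket X Y x (?G U V) = X x (\<lambda>y. Y y (?G U V)) - Y x (\<lambda>y. X y (?G U V))"
    by (rule lie_bracket_apply[OF smooth_atI[OF g_smooth[OF XY(3,4)] x]])
  have "lie_bracket X Y x (?G U V) =
      ?G (lie_bracket (lie_bracket X Y) U) V x + ?G U (lie_bracket (lie_bracket X Y) V) x
      + metric_lie (lie_bracket X Y) U V x"
    by (rule metric_lie_derivative[OF br[OF X Y] XY(3,4) x])
  then show ?thesis
    unfolding comm sXY sYX
    by (simp add: fX fY UV stable jac g_linear t br XY algebra_simps)
qed

end

context riemannian_manifold
begin

section \<open>Orthogonal projection to coordinate planes\<close>

definition coord_plane :: "('a, 'm) chart \<Rightarrow> 'm set \<Rightarrow> 'a \<Rightarrow> 'a tangent set" where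
  "coord_plane c S x = {v \<in> tangent_space x. \<forall>b\<in>Basis - S. v (\<lambda>y. coords c y \<bullet> b) = 0}"

text \<open>One step of the Gram-Schmidt process for each direction \<open>b\<close>: the projection to the larger plane
  is the projection to the smaller one plus the projection to the line of \<open>n\<close>, the part of
  \<open>\<partial>/\<partial>x\<^sub>b\<close> that is orthogonal to the smaller plane. It stays smooth because \<open>n\<close> has no zeros.\<close>

lemma coord_plane_projection:
  assumes c: "compatible c" and W: "open W" "W \<subseteq> dom_chart c"
    and S: "finite S" "S \<subseteq> Basis" and E: "E \<in> vector_fields W"
  shows "\<exists>P\<in>vector_fields W. \<forall>x\<in>W. P x \<in> coord_plane c S x \<and>
    (\<forall>u\<in>coord_plane c S x. g x (E x - P x) u = 0)"
  using S E
proof (induction S arbitrary: E rule: finite_induct)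
  case empty
  have "u = 0" if "x \<in> W" "u \<in> coord_plane c {} x" for u x
  proof -
    have x: "x \<in> dom_chart c"
      using that W by blast
    have "u \<in> tangent_space x"
      using that by (simp add: coord_plane_def)
    then obtain \<xi> where \<xi>: "u = coord_vector c x \<xi>"
      using tangent_coord_vector[OF _ c x] by blast
    have "\<xi> \<bullet> b = 0" if "b \<in> Basis" for b
      using \<open>u \<in> coord_plane c {} x\<close> that coord_vector_coordinate[OF c x, of \<xi> b]
      by (simp add: coord_plane_def \<xi>)
    then have "\<xi> = 0"
      by (simp add: euclidean_eq_iff[of \<xi> 0])
    then show "u = 0"
      using coord_vector_lincomb[OF c x, of "-1" 0 0] by (simp add: \<xi> fun_eq_iff scale_def)
  qed
  note plane = this
  show ?case
  proof (intro bexI[of _ 0] ballI conjI)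
    fix x assume x: "x \<in> W"
    show "(0 :: 'a vfield) x \<in> coord_plane c {} x"
      unfolding zero_fun_apply[of x] coord_plane_def using tangent_zero by simp
    fix u assume "u \<in> coord_plane c {} x"
    then have "u = 0"
      by (rule plane[OF x])
    then show "g x (E x - (0 :: 'a vfield) x) u = 0"
      unfolding zero_fun_apply[of x] diff_zero
      using g_zero_right[OF vector_fields_tangent[OF empty(2) x]] by simp
  qed (rule vector_fields_zero[OF W(1)])
next
  case (insert b S)
  define d where "d = (\<lambda>x. coord_vector c x b)"
  have d: "d \<in> vector_fields W"
    unfolding d_def by (rule coord_field[OF c W])
  obtain P where P: "P \<in> vector_fields W" "\<And>x. x \<in> W \<Longrightarrow> P x \<in> coord_plane c S x"
    "\<And>x u. x \<in> W \<Longrightarrow> u \<in> coord_plane c S x \<Longrightarrow> g x (E x - P x) u = 0"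
    using insert.IH[OF _ insert.prems(2)] insert.prems(1) by blast
  obtain Q where Q: "Q \<in> vector_fields W" "\<And>x. x \<in> W \<Longrightarrow> Q x \<in> coord_plane c S x"
    "\<And>x u. x \<in> W \<Longrightarrow> u \<in> coord_plane c S x \<Longrightarrow> g x (d x - Q x) u = 0"
    using insert.IH[OF _ d] insert.prems(1) by blast
  define n where "n = d - Q"
  have n: "n \<in> vector_fields W"
    unfolding n_def by (rule vector_fields_minus[OF d Q(1)])
  have b: "b \<in> Basis"
    using insert.prems(1) by simp
  have d_coord: "d x (\<lambda>y. coords c y \<bullet> b') = (if b' = b then 1 else 0)"
    if "x \<in> W" "b' \<in> Basis" for x b'
    using that W(2) coord_vector_coordinate[OF c, of x b b'] b
    by (auto simp: d_def inner_Basis)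
  have n_coord: "n x (\<lambda>y. coords c y \<bullet> b) = 1" if "x \<in> W" for x
    using that Q(2)[OF that] d_coord[OF that b] b insert.hyps(2)
    by (simp add: n_def coord_plane_def)
  have n_pos: "g x (n x) (n x) \<noteq> 0" if "x \<in> W" for x
  proof -
    have "n x \<noteq> 0"
      using n_coord[OF that] by auto
    then show ?thesis
      using g_pos[OF vector_fields_tangent[OF n that]] by simp
  qed
  define k where "k x = g x (E x) (n x) / g x (n x) (n x)" for x
  have k: "smooth_fun W k"
    unfolding k_def using g_smooth n insert.prems(2) n_pos by (intro smooth_fun_divide) auto
  let ?P = "P + fscale k n"
  show ?case
  proof (intro bexI[of _ ?P] ballI conjI)
    show "?P \<in> vector_fields W"
      using k n P(1) by (intro vector_fields_plus vector_fields_fscale)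
    fix x assume x: "x \<in> W"
    note t = vector_fields_tangent[OF _ x] P(1) Q(1) d n insert.prems(2)
      tangent_plus tangent_scale tangent_minus
    have "?P x \<in> tangent_space x"
      using k n P(1) by (intro vector_fields_tangent[OF _ x] vector_fields_plus vector_fields_fscale)
    then show "?P x \<in> coord_plane c (insert b S) x"
      using P(2)[OF x] Q(2)[OF x] d_coord[OF x]
      by (auto simp: coord_plane_def fscale_def scale_def n_def)
    fix u assume u: "u \<in> coord_plane c (insert b S) x"
    define r where "r = u (\<lambda>y. coords c y \<bullet> b)"
    define s where "s = u - scale r (n x)"
    have ut: "u \<in> tangent_space x"
      using u by (simp add: coord_plane_def)
    have st: "s \<in> tangent_space x"
      by (simp add: s_def ut t)
    then have s: "s \<in> coord_plane c S x"
      using u Q(2)[OF x] d_coord[OF x] n_coord[OF x]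
      by (auto simp: coord_plane_def s_def r_def scale_def n_def)
    have u_eq: "u = s + scale r (n x)"
      by (simp add: s_def)
    have ns: "g x (n x) w = 0" if "w \<in> coord_plane c S x" for w
      using Q(3)[OF x that] by (simp add: n_def)
    have Pt: "P x \<in> coord_plane c S x"
      by (rule P(2)[OF x])
    have Es: "g x (E x) s = g x (P x) s"
      using P(3)[OF x s] st by (simp add: g_linear t)
    have nP: "g x (P x) (n x) = 0"
      using ns[OF Pt] g_sym[of "P x" x "n x"] by (simp add: t)
    have kn: "k x * g x (n x) (n x) = g x (E x) (n x)"
      using n_pos[OF x] by (simp add: k_def)
    show "g x (E x - ?P x) u = 0"
      unfolding u_eq
      by (simp add: fscale_def g_linear t st Es nP kn ns[OF s])
  qed
qed

end

context foliated_manifold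
begin

section \<open>Vertical vectors\<close>

lemma foliated_chart_compatible: "c \<in> \<F> \<Longrightarrow> compatible c"
  using foliated_atlas_compatible smooth_atlas unfolding compatible_def smooth_atlas_def by blast

lemma foliated_chart_at: obtains c where "c \<in> \<F>" "x \<in> dom_chart c"
  using foliated_atlas_cover by blast

lemma transverse_inner: "b \<in> Basis - B \<Longrightarrow> transverse B u \<bullet> b = u \<bullet> b"
  by (simp add: transverse_def inner_sum_left inner_Basis if_distrib cong: if_cong)

text \<open>Along the line through a point in a leaf direction, a function of the transverse coordinates
  is constant.\<close>

lemma coord_vector_transverse_function:
  assumes c: "c \<in> \<F>" "x \<in> dom_chart c" and \<xi>: "\<forall>b\<in>Basis - B. \<xi> \<bullet> b = 0"
    and N: "open N" "x \<in> N" "\<And>y. y \<in> N \<inter> dom_chart c \<Longrightarrow> f y = F (transverse B (coords c y))"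
  shows "coord_vector c x \<xi> f = 0"
proof (cases "smooth_at x f")
  case True
  note c' = foliated_chart_compatible[OF c(1)] c(2)
  let ?u = "coords c x" and ?L = "\<lambda>\<xi>. coord_vector c x \<xi> f"
  let ?S = "coords c ` (dom_chart c \<inter> N)"
  have S: "open ?S"
    using c' N by (intro chart_image_open compatible_chart)
  have line: "((\<lambda>t. ?u + t *\<^sub>R \<xi>) has_derivative (\<lambda>t. t *\<^sub>R \<xi>)) (at (0::real))"
    by (auto intro!: derivative_eq_intros)
  have "((f \<circ> param c) \<circ> (\<lambda>t. ?u + t *\<^sub>R \<xi>) has_derivative ?L \<circ> (\<lambda>t. t *\<^sub>R \<xi>)) (at (0::real))"
    using coord_vector_has_derivative[OF c' True] by (intro diff_chain_at line) simp
  moreover have "((f \<circ> param c) \<circ> (\<lambda>t. ?u + t *\<^sub>R \<xi>) has_derivative (\<lambda>t. 0)) (at (0::real))"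
  proof (rule has_derivative_transform_within_open[OF has_derivative_const])
    show "open ((\<lambda>t::real. ?u + t *\<^sub>R \<xi>) -` ?S)"
      by (intro open_vimage S continuous_intros)
    show "0 \<in> (\<lambda>t::real. ?u + t *\<^sub>R \<xi>) -` ?S"
      using c N by auto
    fix t :: real assume "t \<in> (\<lambda>t. ?u + t *\<^sub>R \<xi>) -` ?S"
    then obtain y where y: "y \<in> dom_chart c" "y \<in> N" "?u + t *\<^sub>R \<xi> = coords c y"
      by auto
    have "transverse B (coords c y) = transverse B ?u"
      unfolding y(3)[symmetric] transverse_def
      by (rule sum.cong) (auto simp: inner_add_left \<xi>)
    then show "f x = ((f \<circ> param c) \<circ> (\<lambda>t. ?u + t *\<^sub>R \<xi>)) t"
      using y N c c' by (simp add: param_coords compatible_chart)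
  qed
  ultimately have "?L \<circ> (\<lambda>t. t *\<^sub>R \<xi>) = (\<lambda>t::real. 0)"
    by (rule has_derivative_unique)
  then have "(?L \<circ> (\<lambda>t. t *\<^sub>R \<xi>)) 1 = 0"
    by metis
  then show ?thesis
    by simp
qed (simp add: coord_vector_def)

text \<open>By the form of the transition functions, it suffices to test verticality in one foliated
  chart.\<close>

lemma vertical_spaceI:
  assumes "v \<in> tangent_space x" "c \<in> \<F>" "x \<in> dom_chart c"
    and "\<And>b. b \<in> Basis - B \<Longrightarrow> v (\<lambda>y. coords c y \<bullet> b) = 0"
  shows "v \<in> vertical_space x"
  unfolding vertical_space_def
proof (intro CollectI conjI ballI impI assms(1))
  fix d b assume d: "d \<in> \<F>" "x \<in> dom_chart d" and b: "b \<in> Basis - B"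
  note c' = foliated_chart_compatible[OF assms(2)] assms(3)
  obtain \<xi> where v: "v = coord_vector c x \<xi>"
    by (rule tangent_coord_vector[OF assms(1) c'])
  have \<xi>: "\<forall>b\<in>Basis - B. \<xi> \<bullet> b = 0"
    using assms(4) coord_vector_coordinate[OF c'] by (simp add: v)
  obtain N h where N: "open N" "x \<in> N" "N \<subseteq> dom_chart c \<inter> dom_chart d"
    "\<And>y. y \<in> N \<Longrightarrow> transverse B (coords d y) = h (transverse B (coords c y))"
    using foliated_transitions[OF assms(2) d(1), of x] assms(3) d(2) by blast
  have "coords d y \<bullet> b = h (transverse B (coords c y)) \<bullet> b" if "y \<in> N" for y
    using N(4)[OF that] transverse_inner[OF b, of "coords d y"] by simp
  then show "v (\<lambda>y. coords d y \<bullet> b) = 0"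
    unfolding v
    by (intro coord_vector_transverse_function[OF assms(2,3) \<xi> N(1,2), where F = "\<lambda>w. h w \<bullet> b"])
      auto
qed

lemma vertical_tangent: "v \<in> vertical_space x \<Longrightarrow> v \<in> tangent_space x"
  by (simp add: vertical_space_def)

lemma vertical_coord_vector:
  assumes "v \<in> vertical_space x" "c \<in> \<F>" "x \<in> dom_chart c"
  obtains \<xi> where "v = coord_vector c x \<xi>" "\<forall>b\<in>Basis - B. \<xi> \<bullet> b = 0"
proof -
  note c' = foliated_chart_compatible[OF assms(2)] assms(3)
  obtain \<xi> where v: "v = coord_vector c x \<xi>"
    by (rule tangent_coord_vector[OF vertical_tangent[OF assms(1)] c'])
  have "\<forall>b\<in>Basis - B. \<xi> \<bullet> b = 0"
    using assms unfolding vertical_space_def v by (auto simp: coord_vector_coordinate[OF c'])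
  then show thesis
    by (rule that[OF v])
qed

lemma vertical_transverse_function:
  assumes "v \<in> vertical_space x" "c \<in> \<F>" "x \<in> dom_chart c"
    and "open N" "x \<in> N" "\<And>y. y \<in> N \<Longrightarrow> f y = F (transverse B (coords c y))"
  shows "v f = 0"
proof -
  obtain \<xi> where "v = coord_vector c x \<xi>" "\<forall>b\<in>Basis - B. \<xi> \<bullet> b = 0"
    by (rule vertical_coord_vector[OF assms(1-3)])
  then show ?thesis
    using coord_vector_transverse_function[OF assms(2,3) _ assms(4,5), of \<xi> f F] assms(6) by auto
qed

lemma vertical_minus: "u \<in> vertical_space x \<Longrightarrow> v \<in> vertical_space x \<Longrightarrow> u - v \<in> vertical_space x"
  by (simp add: vertical_space_def tangent_minus)

lemma vertical_zero: "0 \<in> vertical_space x"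
  by (simp add: vertical_space_def tangent_zero)

lemma vertical_fields_field: "U \<in> vertical_fields W \<Longrightarrow> U \<in> vector_fields W"
  by (simp add: vertical_fields_def)

lemma vertical_fields_vertical: "U \<in> vertical_fields W \<Longrightarrow> x \<in> W \<Longrightarrow> U x \<in> vertical_space x"
  by (simp add: vertical_fields_def)

lemma leaf_coord_field:
  assumes "c \<in> \<F>" "open W" "W \<subseteq> dom_chart c" "\<forall>b\<in>Basis - B. \<xi> \<bullet> b = 0"
  shows "(\<lambda>x. coord_vector c x \<xi>) \<in> vertical_fields W"
proof -
  note c' = foliated_chart_compatible[OF assms(1)]
  have "coord_vector c x \<xi> \<in> vertical_space x" if "x \<in> W" for x
    using that assms coord_vector_tangent[OF c'] coord_vector_coordinate[OF c']
    by (intro vertical_spaceI[OF _ assms(1)]) auto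
  then show ?thesis
    using coord_field[OF c' assms(2,3)] by (simp add: vertical_fields_def)
qed

text \<open>Constant coefficients in a foliated chart extend the vector.\<close>

lemma vertical_extension:
  assumes "v \<in> vertical_space x" "open W" "x \<in> W"
  obtains N U where "x \<in> N" "N \<subseteq> W" "U \<in> vertical_fields N" "U x = v"
proof -
  obtain c where c: "c \<in> \<F>" "x \<in> dom_chart c"
    by (rule foliated_chart_at)
  obtain \<xi> where \<xi>: "v = coord_vector c x \<xi>" "\<forall>b\<in>Basis - B. \<xi> \<bullet> b = 0"
    by (rule vertical_coord_vector[OF assms(1) c])
  have "open (W \<inter> dom_chart c)"
    using assms(2) chart_dom_open[OF compatible_chart[OF foliated_chart_compatible[OF c(1)]]] by blast
  from leaf_coord_field[OF c(1) this _ \<xi>(2)] show thesis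
    by (intro that[of "W \<inter> dom_chart c" "\<lambda>x. coord_vector c x \<xi>"]) (use assms c \<xi> in auto)
qed

text \<open>Since \<open>p \<ge> 1\<close>, a foliated chart has a coordinate field in a leaf direction.\<close>

lemma nonvanishing_vertical_field:
  assumes "open W" "x \<in> W"
  obtains N U where "x \<in> N" "N \<subseteq> W" "U \<in> vertical_fields N" "\<forall>y\<in>N. U y \<noteq> 0"
proof -
  obtain c where c: "c \<in> \<F>" "x \<in> dom_chart c"
    by (rule foliated_chart_at)
  note c' = foliated_chart_compatible[OF c(1)]
  obtain e where e: "e \<in> B"
    using leaf_dimension by fastforce
  then have eb: "e \<in> Basis"
    using leaf_directions by blast
  have "open (W \<inter> dom_chart c)"
    using assms(1) chart_dom_open[OF compatible_chart[OF c']] by blast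
  then have "(\<lambda>x. coord_vector c x e) \<in> vertical_fields (W \<inter> dom_chart c)"
    using e eb by (intro leaf_coord_field[OF c(1)]) (auto simp: inner_Basis)
  moreover have "coord_vector c y e \<noteq> 0" if "y \<in> W \<inter> dom_chart c" for y
  proof
    assume "coord_vector c y e = 0"
    then show False
      using coord_vector_coordinate[OF c', of y e e] that eb by simp
  qed
  ultimately show thesis
    by (intro that[of "W \<inter> dom_chart c" "\<lambda>x. coord_vector c x e"]) (use assms c in auto)
qed

lemma projectableE:
  assumes "projectable W X" "c \<in> \<F>" "x \<in> W" "x \<in> dom_chart c"
  obtains N \<Xi> where "open N" "x \<in> N" "N \<subseteq> W \<inter> dom_chart c"
    "\<forall>y\<in>N. \<forall>b\<in>Basis - B.
      X y (\<lambda>z. coords c z \<bullet> b) = \<Xi> (transverse B (coords c y)) \<bullet> b"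
  using bspec[OF bspec[OF assms(1)[unfolded projectable_def] assms(2)] IntI[OF assms(3,4)]]
  by blast

lemma projectable_subset:
  assumes "projectable W X" "open N" "N \<subseteq> W"
  shows "projectable N X"
  unfolding projectable_def
proof (intro ballI)
  fix c x assume c: "c \<in> \<F>" "x \<in> N \<inter> dom_chart c"
  then have "x \<in> W" "x \<in> dom_chart c"
    using assms(3) by auto
  then obtain M \<Xi> where M: "open M" "x \<in> M" "M \<subseteq> W \<inter> dom_chart c"
    "\<forall>y\<in>M. \<forall>b\<in>Basis - B.
      X y (\<lambda>z. coords c z \<bullet> b) = \<Xi> (transverse B (coords c y)) \<bullet> b"
    by (rule projectableE[OF assms(1) c(1)])
  then show "\<exists>M \<Xi>. open M \<and> x \<in> M \<and> M \<subseteq> N \<inter> dom_chart c \<and>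
      (\<forall>y\<in>M. \<forall>b\<in>Basis - B. X y (\<lambda>z. coords c z \<bullet> b) = \<Xi> (transverse B (coords c y)) \<bullet> b)"
    using assms(2) c by (intro exI[of _ "M \<inter> N"] exI[of _ \<Xi>]) auto
qed

lemma projectable_plus:
  assumes "projectable W X" "projectable W Y"
  shows "projectable W (X + Y)"
  unfolding projectable_def
proof (intro ballI)
  fix c x assume c: "c \<in> \<F>" "x \<in> W \<inter> dom_chart c"
  then have x: "x \<in> W" "x \<in> dom_chart c"
    by auto
  obtain M \<Xi> where M: "open M" "x \<in> M" "M \<subseteq> W \<inter> dom_chart c"
    "\<forall>y\<in>M. \<forall>b\<in>Basis - B.
      X y (\<lambda>z. coords c z \<bullet> b) = \<Xi> (transverse B (coords c y)) \<bullet> b"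
    by (rule projectableE[OF assms(1) c(1) x])
  obtain M' \<Xi>' where M': "open M'" "x \<in> M'" "M' \<subseteq> W \<inter> dom_chart c"
    "\<forall>y\<in>M'. \<forall>b\<in>Basis - B.
      Y y (\<lambda>z. coords c z \<bullet> b) = \<Xi>' (transverse B (coords c y)) \<bullet> b"
    by (rule projectableE[OF assms(2) c(1) x])
  show "\<exists>N \<Xi>. open N \<and> x \<in> N \<and> N \<subseteq> W \<inter> dom_chart c \<and> (\<forall>y\<in>N. \<forall>b\<in>Basis - B.
      (X + Y) y (\<lambda>z. coords c z \<bullet> b) = \<Xi> (transverse B (coords c y)) \<bullet> b)"
    using M M'
    by (intro exI[of _ "M \<inter> M'"] exI[of _ "\<lambda>w. \<Xi> w + \<Xi>' w"]) (auto simp: inner_add_left)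
qed

text \<open>In a foliated chart, the transverse components of a projectable field depend only on the
  transverse coordinates, so \<open>U\<close> annihilates them; those of \<open>U\<close> vanish.\<close>

lemma lie_bracket_projectable_vertical:
  assumes X: "X \<in> vector_fields W" "projectable W X" and U: "U \<in> vertical_fields W"
    and x: "x \<in> W" and tangent: "lie_bracket X U x \<in> tangent_space x"
  shows "lie_bracket X U x \<in> vertical_space x"
proof -
  obtain c where c: "c \<in> \<F>" "x \<in> dom_chart c"
    by (rule foliated_chart_at)
  note c' = foliated_chart_compatible[OF c(1)] c(2)
  obtain N \<Xi> where N: "open N" "x \<in> N" "N \<subseteq> W \<inter> dom_chart c"
    "\<forall>y\<in>N. \<forall>b\<in>Basis - B.
      X y (\<lambda>z. coords c z \<bullet> b) = \<Xi> (transverse B (coords c y)) \<bullet> b"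
    by (rule projectableE[OF X(2) c(1) x c(2)])
  show ?thesis
  proof (rule vertical_spaceI[OF tangent c])
    fix b assume b: "b \<in> Basis - B"
    have "U x (\<lambda>y. X y (\<lambda>z. coords c z \<bullet> b)) = 0"
      by (rule vertical_transverse_function[OF vertical_fields_vertical[OF U x] c N(1,2),
            where F = "\<lambda>w. \<Xi> w \<bullet> b"]) (use N(4) b in blast)
    moreover have "X x (\<lambda>y. U y (\<lambda>z. coords c z \<bullet> b)) = X x (\<lambda>_. 0)"
      by (rule tangent_cong[OF vector_fields_tangent[OF X(1) x] N(1,2)])
        (use U N(3) c b in \<open>auto simp: vertical_fields_def vertical_space_def\<close>)
    ultimately show "lie_bracket X U x (\<lambda>y. coords c y \<bullet> b) = 0"
      using tangent_const[OF vector_fields_tangent[OF X(1) x], of 0]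
      by (simp add: lie_bracket_apply[OF smooth_at_coordinate[OF c']])
  qed
qed

end

context foliated_riemannian
begin

sublocale riemannian_manifold \<A> g D
  by unfold_locales (rule metric, rule levi_civita)

section \<open>Vertical and horizontal parts\<close>

lemma vertical_space_coord_plane:
  assumes "c \<in> \<F>" "x \<in> dom_chart c"
  shows "vertical_space x = coord_plane c B x"
  using assms by (auto simp: coord_plane_def intro: vertical_spaceI) (auto simp: vertical_space_def)

lemma horizontal_tangent: "v \<in> horizontal_space x \<Longrightarrow> v \<in> tangent_space x"
  by (simp add: horizontal_space_def)

lemma horizontal_vertical:
  "u \<in> horizontal_space x \<Longrightarrow> v \<in> vertical_space x \<Longrightarrow> g x u v = 0"
  "u \<in> horizontal_space x \<Longrightarrow> v \<in> vertical_space x \<Longrightarrow> g x v u = 0"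
  using g_sym[of v x u] by (simp_all add: horizontal_space_def vertical_tangent)

lemma horizontal_zero: "0 \<in> horizontal_space x"
  by (simp add: horizontal_space_def tangent_zero g_zero_left vertical_tangent)

lemma horizontal_plus:
  "u \<in> horizontal_space x \<Longrightarrow> v \<in> horizontal_space x \<Longrightarrow> u + v \<in> horizontal_space x"
  by (simp add: horizontal_space_def tangent_plus g_plus_left vertical_tangent)

lemma horizontal_scale: "u \<in> horizontal_space x \<Longrightarrow> scale r u \<in> horizontal_space x"
  by (simp add: horizontal_space_def tangent_scale g_scale_left vertical_tangent)

lemma horizontal_minus:
  "u \<in> horizontal_space x \<Longrightarrow> v \<in> horizontal_space x \<Longrightarrow> u - v \<in> horizontal_space x"
  by (simp add: horizontal_space_def tangent_minus g_minus_left vertical_tangent)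

lemma horizontal_fields_field: "X \<in> horizontal_fields W \<Longrightarrow> X \<in> vector_fields W"
  by (simp add: horizontal_fields_def)

lemma horizontal_fields_horizontal:
  "X \<in> horizontal_fields W \<Longrightarrow> x \<in> W \<Longrightarrow> X x \<in> horizontal_space x"
  by (simp add: horizontal_fields_def)

lemma vert_eqI:
  assumes "v \<in> vertical_space x" "E x - v \<in> horizontal_space x"
  shows "vert E x = v"
  unfolding vert_def
proof (rule the_equality)
  fix w assume w: "w \<in> vertical_space x \<and> E x - w \<in> horizontal_space x"
  then have wv: "w - v \<in> vertical_space x"
    using assms(1) by (simp add: vertical_minus)
  \<comment> \<open>\<open>w - v\<close> is both vertical and horizontal\<close>
  have "(E x - v) - (E x - w) \<in> horizontal_space x"
    using w assms(2) by (blast intro: horizontal_minus)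
  then have "g x (w - v) (w - v) = 0"
    using horizontal_vertical(1)[OF _ wv] by simp
  then show "w = v"
    using g_pos[OF vertical_tangent[OF wv]] by fastforce
qed (use assms in simp)

lemma vert_cong: "E x = E' x \<Longrightarrow> vert E x = vert E' x"
  by (simp add: vert_def)

lemma hor_cong: "E x = E' x \<Longrightarrow> hor E x = hor E' x"
  by (simp add: hor_def vert_cong[of E x E'])

lemma vert_vertical: "E x \<in> vertical_space x \<Longrightarrow> vert E x = E x"
  by (rule vert_eqI) (simp_all add: horizontal_zero)

lemma vert_horizontal: "E x \<in> horizontal_space x \<Longrightarrow> vert E x = 0"
  by (rule vert_eqI) (simp_all add: vertical_zero)

lemma hor_vertical: "E x \<in> vertical_space x \<Longrightarrow> hor E x = 0"
  by (simp add: hor_def vert_vertical)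

lemma hor_horizontal: "E x \<in> horizontal_space x \<Longrightarrow> hor E x = E x"
  by (simp add: hor_def vert_horizontal)

text \<open>In a foliated chart the vertical spaces are the coordinate planes of \<open>B\<close>, so the smooth
  projection to these planes is the vertical part.\<close>

lemma vert_hor_local:
  assumes "E \<in> vector_fields W" "x \<in> W"
  shows "\<exists>N. x \<in> N \<and> N \<subseteq> W \<and> vert E \<in> vector_fields N"
    and "vert E x \<in> vertical_space x" "hor E x \<in> horizontal_space x"
proof -
  obtain c where c: "c \<in> \<F>" "x \<in> dom_chart c"
    by (rule foliated_chart_at)
  note c' = foliated_chart_compatible[OF c(1)]
  let ?N = "W \<inter> dom_chart c"
  have N: "open ?N"
    using vector_fields_open[OF assms(1)] chart_dom_open[OF compatible_chart[OF c']] by blast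
  have "finite B"
    by (rule finite_subset[OF leaf_directions finite_Basis])
  from coord_plane_projection[OF c' N _ this leaf_directions vector_fields_subset[OF assms(1) N]]
  obtain P where P: "P \<in> vector_fields ?N"
    and Py: "\<And>y. y \<in> ?N \<Longrightarrow> P y \<in> coord_plane c B y \<and>
      (\<forall>u\<in>coord_plane c B y. g y (E y - P y) u = 0)"
    by blast
  have "P y \<in> vertical_space y \<and> E y - P y \<in> horizontal_space y" if y: "y \<in> ?N" for y
    using Py[OF y] y c(1) vertical_space_coord_plane[OF c(1), of y]
      tangent_minus[OF vector_fields_tangent[OF assms(1), of y] vector_fields_tangent[OF P y]]
    by (simp add: horizontal_space_def)
  moreover from this have eq: "vert E y = P y" if "y \<in> ?N" for y
    using that vert_eqI by blast
  ultimately show "vert E x \<in> vertical_space x" "hor E x \<in> horizontal_space x"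
    using c(2) assms(2) by (auto simp: hor_def)
  have "vert E \<in> vector_fields ?N"
    by (rule vector_fields_cong[OF P]) (simp add: eq)
  then show "\<exists>N. x \<in> N \<and> N \<subseteq> W \<and> vert E \<in> vector_fields N"
    using c(2) assms(2) by (intro exI[of _ ?N]) auto
qed

lemma vert_field:
  assumes "E \<in> vector_fields W"
  shows "vert E \<in> vertical_fields W"
  using vector_fields_locally[OF vert_hor_local(1)[OF assms]] vert_hor_local(2)[OF assms]
  by (simp add: vertical_fields_def)

lemma hor_field:
  assumes "E \<in> vector_fields W"
  shows "hor E \<in> horizontal_fields W"
  using vector_fields_minus[OF assms vertical_fields_field[OF vert_field[OF assms]]]
    vert_hor_local(3)[OF assms]
  by (simp add: horizontal_fields_def hor_def)

lemma g_vert: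
  assumes "E \<in> vector_fields W" "x \<in> W" "v \<in> vertical_space x"
  shows "g x (vert E x) v = g x (E x) v"
proof -
  have "g x (E x - vert E x) v = 0"
    using vert_hor_local(3)[OF assms(1,2)] horizontal_vertical(1)[OF _ assms(3)]
    by (simp add: hor_def)
  then show ?thesis
    using vert_hor_local(2)[OF assms(1,2)] vector_fields_tangent[OF assms(1,2)] assms(3)
    by (simp add: g_minus_left vertical_tangent)
qed

lemma g_hor:
  assumes "E \<in> vector_fields W" "x \<in> W" "v \<in> horizontal_space x"
  shows "g x v (hor E x) = g x v (E x)"
proof -
  have "g x v (vert E x) = 0"
    by (rule horizontal_vertical(1)[OF assms(3) vert_hor_local(2)[OF assms(1,2)]])
  then show ?thesis
    using vertical_tangent[OF vert_hor_local(2)[OF assms(1,2)]] vector_fields_tangent[OF assms(1,2)]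
      horizontal_tangent[OF assms(3)]
    by (simp add: hor_def g_minus_right)
qed

section \<open>The O'Neill tensors and the mean curvature\<close>

lemma oneill_T_vertical:
  assumes U: "U \<in> vertical_fields W" and V: "V \<in> vertical_fields W" and x: "x \<in> W"
  shows "oneill_T U V x = hor (D U V) x"
proof -
  have W: "open W"
    using U by (auto dest: vertical_fields_field vector_fields_open)
  have eq: "vert U y = U y" "vert V y = V y" "hor V y = 0" if "y \<in> W" for y
    using that U V by (auto intro: vert_vertical hor_vertical vertical_fields_vertical)
  have fields: "vert U \<in> vector_fields W" "vert V \<in> vector_fields W" "hor V \<in> vector_fields W"
    using U V by (auto intro: vertical_fields_field horizontal_fields_field vert_field hor_field)
  have "D (vert U) (hor V) x = 0"
    by (rule connection_vanishing(2)[OF fields(3) eq(3) fields(1) x])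
  moreover have "D (vert U) (vert V) x = D U V x"
    by (rule connection_cong[OF fields(1,2) eq(1,2) x])
  ultimately show ?thesis
    using hor_cong[of "D (vert U) (vert V)" x "D U V"] vert_horizontal[of "D (vert U) (hor V)" x]
      horizontal_zero[of x]
    by (simp add: oneill_T_def)
qed

lemma oneill_A_horizontal:
  assumes X: "X \<in> horizontal_fields W" and Y: "Y \<in> horizontal_fields W" and x: "x \<in> W"
  shows "oneill_A X Y x = vert (D X Y) x"
proof -
  have eq: "hor X y = X y" "hor Y y = Y y" "vert Y y = 0" if "y \<in> W" for y
    using that X Y by (auto intro: vert_horizontal hor_horizontal horizontal_fields_horizontal)
  have fields: "hor X \<in> vector_fields W" "hor Y \<in> vector_fields W" "vert Y \<in> vector_fields W"
    using X Y by (auto intro: vertical_fields_field horizontal_fields_field vert_field hor_field)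
  have "D (hor X) (vert Y) x = 0"
    by (rule connection_vanishing(2)[OF fields(3) eq(3) fields(1) x])
  moreover have "D (hor X) (hor Y) x = D X Y x"
    by (rule connection_cong[OF fields(1,2) eq(1,2) x])
  ultimately show ?thesis
    using vert_cong[of "D (hor X) (hor Y)" x "D X Y"] hor_vertical[of "D (hor X) (vert Y)" x]
      vertical_zero[of x]
    by (simp add: oneill_A_def)
qed

text \<open>Umbilicity, read for a vertical field \<open>U\<close> without zeros, gives \<open>\<tau> = (p / g(U,U)) T\<^sub>U U\<close>. So
  \<open>\<tau>\<close> inherits smoothness and horizontality from the tensor \<open>T\<close>.\<close>

lemma mean_curvature_field:
  assumes "totally_umbilical" "open W"
  shows "mean_curvature \<in> horizontal_fields W"
proof -
  have local: "\<exists>N. x \<in> N \<and> N \<subseteq> W \<and> mean_curvature \<in> horizontal_fields N" if x: "x \<in> W" for x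
  proof -
    obtain N U where N: "x \<in> N" "N \<subseteq> W" and U: "U \<in> vertical_fields N"
      and nz: "\<forall>y\<in>N. U y \<noteq> 0"
      by (rule nonvanishing_vertical_field[OF assms(2) x])
    note Uf = vertical_fields_field[OF U]
    have pos: "g y (U y) (U y) \<noteq> 0" if "y \<in> N" for y
      using g_pos[OF vector_fields_tangent[OF Uf that] bspec[OF nz that]] by simp
    let ?k = "\<lambda>y. real p / g y (U y) (U y)"
    have k: "smooth_fun N ?k"
      using vector_fields_open[OF Uf] g_smooth[OF Uf Uf] pos
      by (intro smooth_fun_divide smooth_fun_const)
    note H = hor_field[OF connection_field[OF Uf Uf]]
    have eq: "fscale ?k (hor (D U U)) y = mean_curvature y" if y: "y \<in> N" for y
    proof -
      have "hor (D U U) y = scale (1 / real p * g y (U y) (U y)) (mean_curvature y)"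
        using assms(1) U y unfolding totally_umbilical_def oneill_T_vertical[OF U U y, symmetric]
        by blast
      then show ?thesis
        using pos[OF y] leaf_dimension(2) by (simp add: fscale_def scale_def fun_eq_iff)
    qed
    have "mean_curvature \<in> vector_fields N"
      by (rule vector_fields_cong[OF vector_fields_fscale[OF k horizontal_fields_field[OF H]] eq])
    moreover have "mean_curvature y \<in> horizontal_space y" if "y \<in> N" for y
      using horizontal_scale[OF horizontal_fields_horizontal[OF H that]] eq[OF that]
      by (metis fscale_def)
    ultimately show ?thesis
      using N by (auto simp: horizontal_fields_def)
  qed
  have "mean_curvature \<in> vector_fields W"
    by (rule vector_fields_locally) (use local horizontal_fields_field in blast)
  moreover have "mean_curvature x \<in> horizontal_space x" if "x \<in> W" for x
    using local[OF that] horizontal_fields_horizontal by blast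
  ultimately show ?thesis
    by (simp add: horizontal_fields_def)
qed

text \<open>Since \<open>g(Z,V) = 0\<close>, the vertical part of \<open>D\<^sub>U Z\<close> is the negative of the shape operator in
  the direction \<open>Z\<close>; on umbilical leaves it is a multiple of the identity.\<close>

lemma connection_horizontal_umbilical:
  assumes umb: "totally_umbilical" and Z: "Z \<in> horizontal_fields W"
    and U: "U \<in> vertical_fields W" and V: "V \<in> vertical_fields W" and x: "x \<in> W"
  shows "g x (D U Z x) (V x) = - (1 / real p) * g x (Z x) (mean_curvature x) * g x (U x) (V x)"
proof -
  note f = horizontal_fields_field[OF Z] vertical_fields_field[OF U] vertical_fields_field[OF V]
  have W: "open W"
    by (rule vector_fields_open[OF f(1)])
  have \<tau>: "mean_curvature x \<in> tangent_space x"
    using horizontal_fields_horizontal[OF mean_curvature_field[OF umb W] x]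
    by (rule horizontal_tangent)
  have "U x (\<lambda>y. g y (Z y) (V y)) = U x (\<lambda>_. 0)"
    by (rule tangent_cong[OF vector_fields_tangent[OF f(2) x] W x])
      (use Z V in \<open>blast intro: horizontal_vertical horizontal_fields_horizontal
        vertical_fields_vertical\<close>)
  also have "\<dots> = 0"
    by (rule tangent_const[OF vector_fields_tangent[OF f(2) x]])
  finally have "g x (D U Z x) (V x) = - g x (Z x) (D U V x)"
    using connection_metric[OF f(2,1,3) x] by simp
  also have "g x (Z x) (D U V x) = g x (Z x) (hor (D U V) x)"
    by (rule g_hor[OF connection_field[OF f(2,3)] x horizontal_fields_horizontal[OF Z x], symmetric])
  also have "hor (D U V) x = scale (1 / real p * g x (U x) (V x)) (mean_curvature x)"
    using umb U V x unfolding totally_umbilical_def oneill_T_vertical[OF U V x, symmetric]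
    by blast
  finally show ?thesis
    by (simp add: g_scale_right[OF \<tau> vector_fields_tangent[OF f(1) x]])
qed

lemma metric_lie_horizontal_umbilical:
  assumes umb: "totally_umbilical" and Z: "Z \<in> horizontal_fields W"
    and U: "U \<in> vertical_fields W" and V: "V \<in> vertical_fields W" and x: "x \<in> W"
  shows "metric_lie Z U V x = - (2 / real p) * g x (Z x) (mean_curvature x) * g x (U x) (V x)"
proof -
  note f = horizontal_fields_field[OF Z] vertical_fields_field[OF U] vertical_fields_field[OF V]
  have "g x (U x) (D V Z x) = g x (D V Z x) (U x)" "g x (V x) (U x) = g x (U x) (V x)"
    using g_sym connection_tangent[OF f(3,1) x] vector_fields_tangent[OF _ x] f by blast+
  then show ?thesis
    by (simp add: metric_lie_def connection_horizontal_umbilical[OF umb Z U V x]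
        connection_horizontal_umbilical[OF umb Z V U x] field_simps)
qed

section \<open>Basic fields\<close>

lemma basic_fields_horizontal: "X \<in> basic_fields W \<Longrightarrow> X \<in> horizontal_fields W"
  by (simp add: basic_fields_def)

lemma basic_fields_field: "X \<in> basic_fields W \<Longrightarrow> X \<in> vector_fields W"
  by (simp add: basic_fields_def horizontal_fields_def)

lemma basic_fields_subset:
  assumes "X \<in> basic_fields W" "open N" "N \<subseteq> W"
  shows "X \<in> basic_fields N"
  using assms projectable_subset[OF _ assms(2,3), of X] vector_fields_subset[OF _ assms(2,3), of X]
  by (auto simp: basic_fields_def horizontal_fields_def)

lemma basic_fields_plus:
  "X \<in> basic_fields W \<Longrightarrow> Y \<in> basic_fields W \<Longrightarrow> X + Y \<in> basic_fields W"
  by (simp add: basic_fields_def horizontal_fields_def projectable_plus vector_fields_plus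
      horizontal_plus)

lemma lie_bracket_basic_vertical:
  assumes "X \<in> basic_fields W" "U \<in> vertical_fields W"
  shows "lie_bracket X U \<in> vertical_fields W"
proof -
  have "lie_bracket X U \<in> vector_fields W"
    by (intro lie_bracket_field basic_fields_field vertical_fields_field assms)
  then show ?thesis
    using lie_bracket_projectable_vertical[OF basic_fields_field[OF assms(1)] _ assms(2)] assms(1)
      vector_fields_tangent
    by (auto simp: vertical_fields_def basic_fields_def)
qed

text \<open>Polarisation of the bundle-like condition.\<close>

lemma bundle_like_inner_constant:
  assumes bl: "bundle_like" and X: "X \<in> basic_fields W" and Y: "Y \<in> basic_fields W"
    and U: "U \<in> vertical_fields W" and x: "x \<in> W"
  shows "U x (\<lambda>y. g y (X y) (Y y)) = 0"
proof -
  let ?h = "\<lambda>X Y y. g y (X y) (Y y)"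
  note f = basic_fields_field[OF X] basic_fields_field[OF Y]
  note u = vector_fields_tangent[OF vertical_fields_field[OF U] x]
  have W: "open W"
    by (rule vector_fields_open[OF f(1)])
  have zero: "U x (?h Z Z) = 0" if "Z \<in> basic_fields W" for Z
    using bl that U x unfolding bundle_like_def by blast
  have sm: "smooth_at x (?h X Y)" "smooth_at x (?h X X)" "smooth_at x (?h Y Y)"
    using g_smooth f x by (blast intro: smooth_atI)+
  have "U x (?h (X + Y) (X + Y)) = U x (\<lambda>y. (?h X X y + ?h Y Y y) + 2 * ?h X Y y)"
  proof (rule tangent_cong[OF u W x])
    fix y assume y: "y \<in> W"
    note t = vector_fields_tangent[OF f(1) y] vector_fields_tangent[OF f(2) y]
    show "?h (X + Y) (X + Y) y = (?h X X y + ?h Y Y y) + 2 * ?h X Y y"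
      using g_sym[OF t] by (simp add: g_plus_left g_plus_right t tangent_plus)
  qed
  also have "\<dots> = U x (?h X X) + U x (?h Y Y) + 2 * U x (?h X Y)"
    by (simp only: tangent_add[OF u smooth_at_add[OF sm(2,3)]
          smooth_at_mult[OF smooth_at_const sm(1)]] tangent_add[OF u sm(2,3)]
        tangent_cmult[OF u sm(1)])
  finally show ?thesis
    using zero[OF X] zero[OF Y] zero[OF basic_fields_plus[OF X Y]] by simp
qed

text \<open>As \<open>[X,U]\<close> and \<open>[Y,U]\<close> are vertical, \<open>g(D\<^sub>X Y + D\<^sub>Y X, U)\<close> equals \<open>- U g(X,Y)\<close>, which
  vanishes. This is the skew symmetry \<open>A\<^sub>X Y = - A\<^sub>Y X\<close>.\<close>

lemma connection_basic_skew:
  assumes bl: "bundle_like" and X: "X \<in> basic_fields W" and Y: "Y \<in> basic_fields W"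
    and x: "x \<in> W" and v: "v \<in> vertical_space x"
  shows "g x (D X Y x) v + g x (D Y X x) v = 0"
proof -
  obtain N U where N: "x \<in> N" "N \<subseteq> W" and U: "U \<in> vertical_fields N" and Ux: "U x = v"
    using vertical_extension[OF v vector_fields_open[OF basic_fields_field[OF X]] x] by metis
  note Uf = vertical_fields_field[OF U]
  note XN = basic_fields_subset[OF X vector_fields_open[OF Uf] N(2)]
  note YN = basic_fields_subset[OF Y vector_fields_open[OF Uf] N(2)]
  note Xf = basic_fields_field[OF XN] and Yf = basic_fields_field[OF YN]
  note t = vector_fields_tangent[OF _ N(1)] connection_tangent[OF _ _ N(1)] Uf Xf Yf
  \<comment> \<open>differentiating \<open>g(Z,U) = 0\<close> along \<open>Z'\<close>\<close>
  have swap: "g x (D Z' Z x) (U x) = - g x (Z x) (D U Z' x)"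
    if Z: "Z \<in> basic_fields N" and Z': "Z' \<in> basic_fields N" for Z Z'
  proof -
    note Zf = basic_fields_field[OF Z] and Zf' = basic_fields_field[OF Z']
    have "Z' x (\<lambda>y. g y (Z y) (U y)) = Z' x (\<lambda>_. 0)"
      by (rule tangent_cong[OF vector_fields_tangent[OF Zf' N(1)] vector_fields_open[OF Uf] N(1)])
        (use Z U in \<open>blast intro: horizontal_vertical horizontal_fields_horizontal
          vertical_fields_vertical basic_fields_horizontal\<close>)
    also have "\<dots> = 0"
      by (rule tangent_const[OF vector_fields_tangent[OF Zf' N(1)]])
    finally have "g x (D Z' Z x) (U x) = - g x (Z x) (D Z' U x)"
      using connection_metric[OF Zf' Zf Uf N(1)] by simp
    moreover have "g x (Z x) (lie_bracket Z' U x) = 0"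
      using lie_bracket_basic_vertical[OF Z' U] Z N(1)
      by (blast intro: horizontal_vertical horizontal_fields_horizontal
          vertical_fields_vertical basic_fields_horizontal)
    ultimately show ?thesis
      using Zf Zf' by (simp add: lie_bracket_connection[OF Zf' Uf N(1)] g_minus_right t)
  qed
  have "U x (\<lambda>y. g y (X y) (Y y)) = 0"
    by (rule bundle_like_inner_constant[OF bl XN YN U N(1)])
  then have "g x (D U X x) (Y x) + g x (X x) (D U Y x) = 0"
    by (simp add: connection_metric[OF Uf Xf Yf N(1)])
  moreover have "g x (D U X x) (Y x) = g x (Y x) (D U X x)"
    by (intro g_sym t)
  ultimately show ?thesis
    using swap[OF XN YN] swap[OF YN XN] by (simp add: Ux)
qed

section \<open>The Killing condition\<close>

text \<open>With \<open>K = A\<^sub>X Y\<close> and \<open>H\<close> the horizontal part of \<open>[X,Y]\<close> one has \<open>[X,Y] = 2 K + H\<close>. On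
  vertical fields \<open>L\<^sub>X g = f\<^sub>X g\<close> with \<open>f\<^sub>X = - (2/p) g(X,\<tau>)\<close>, likewise for \<open>Y\<close> and \<open>H\<close>, so
  \<open>2 L\<^sub>K g = L\<^bsub>[X,Y]\<^esub> g - L\<^sub>H g = (X f\<^sub>Y - Y f\<^sub>X - f\<^sub>H) g\<close>. In the last factor the derivatives of
  \<open>X\<close> and \<open>Y\<close> cancel against \<open>f\<^sub>H\<close> because \<open>D\<close> is torsion-free.\<close>

lemma metric_lie_oneill_A:
  assumes bl: "bundle_like" and umb: "totally_umbilical"
    and X: "X \<in> basic_fields W" and Y: "Y \<in> basic_fields W"
    and U: "U \<in> vertical_fields W" and V: "V \<in> vertical_fields W" and x: "x \<in> W"
  defines "\<tau> \<equiv> mean_curvature"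
  shows "metric_lie (vert (D X Y)) U V x =
    - (1 / real p) * (g x (D X \<tau> x) (Y x) - g x (D Y \<tau> x) (X x)) * g x (U x) (V x)"
proof -
  note f = basic_fields_field[OF X] basic_fields_field[OF Y]
    vertical_fields_field[OF U] vertical_fields_field[OF V]
  have W: "open W"
    by (rule vector_fields_open[OF f(1)])
  have \<tau>: "\<tau> \<in> horizontal_fields W"
    unfolding \<tau>_def by (rule mean_curvature_field[OF umb W])
  note \<tau>f = horizontal_fields_field[OF \<tau>]
  define K where "K = vert (D X Y)"
  define H where "H = lie_bracket X Y - K - K"
  have K: "K \<in> vertical_fields W"
    unfolding K_def by (rule vert_field[OF connection_field[OF f(1,2)]])
  note Kf = vertical_fields_field[OF K]
  have H_field: "H \<in> vector_fields W"
    unfolding H_def by (intro vector_fields_minus lie_bracket_field Kf f)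
  have g_H: "g y (H y) w = g y (D X Y y) w - g y (D Y X y) w - 2 * g y (K y) w"
    if y: "y \<in> W" and w: "w \<in> tangent_space y" for y w
  proof -
    note t = connection_tangent[OF f(1,2) y] connection_tangent[OF f(2,1) y]
      vector_fields_tangent[OF Kf y]
    have eq: "H y = D X Y y - D Y X y - K y - K y"
      unfolding H_def minus_apply lie_bracket_connection[OF f(1,2) y] ..
    show ?thesis
      unfolding eq g_minus_left[OF tangent_minus[OF tangent_minus[OF t(1,2)] t(3)] t(3) w]
        g_minus_left[OF tangent_minus[OF t(1,2)] t(3) w] g_minus_left[OF t(1,2) w]
      by simp
  qed
  have H_vert: "g y (H y) v = 0" if y: "y \<in> W" and v: "v \<in> vertical_space y" for y v
  proof -
    have "g y (K y) v = g y (D X Y y) v"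
      unfolding K_def by (rule g_vert[OF connection_field[OF f(1,2)] y v])
    then show ?thesis
      using connection_basic_skew[OF bl X Y y v] g_H[OF y vertical_tangent[OF v]] by simp
  qed
  have H: "H \<in> horizontal_fields W"
    using H_field H_vert vector_fields_tangent[OF H_field]
    by (simp add: horizontal_fields_def horizontal_space_def)
  let ?f = "\<lambda>Z y. - (2 / real p) * g y (Z y) (\<tau> y)"
  have f_smooth: "smooth_fun W (?f Z)" if "Z \<in> vector_fields W" for Z
    by (intro smooth_fun_mult smooth_fun_const W g_smooth that \<tau>f)
  have f_deriv: "Z x (?f Z') = - (2 / real p) * (g x (D Z Z' x) (\<tau> x) + g x (Z' x) (D Z \<tau> x))"
    if "Z \<in> vector_fields W" "Z' \<in> vector_fields W" for Z Z'
    using tangent_cmult[OF vector_fields_tangent[OF that(1) x] smooth_atI[OF g_smooth[OF that(2) \<tau>f] x],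
        of "- (2 / real p)"] connection_metric[OF that \<tau>f x]
    by simp
  have conformal: "metric_lie Z P Q y = ?f Z y * g y (P y) (Q y)"
    if "Z \<in> horizontal_fields W" "P \<in> vertical_fields W" "Q \<in> vertical_fields W" "y \<in> W"
    for Z P Q y
    unfolding \<tau>_def by (rule metric_lie_horizontal_umbilical[OF umb that])
  have "metric_lie (lie_bracket X Y) U V x = (X x (?f Y) - Y x (?f X)) * g x (U x) (V x)"
  proof (rule metric_lie_bracket_conformal[OF f(1,2) _ _ _ f_smooth[OF f(1)] f_smooth[OF f(2)] _ _
        U V x])
    show "vertical_fields W \<subseteq> vector_fields W"
      using vertical_fields_field by blast
  qed (use X Y conformal lie_bracket_basic_vertical basic_fields_horizontal in blast)+
  moreover have "metric_lie (lie_bracket X Y) U V x = 2 * metric_lie K U V x + metric_lie H U V x"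
  proof -
    have "lie_bracket X Y = K + (K + H)"
      by (simp add: H_def fun_eq_iff)
    then show ?thesis
      using metric_lie_plus[OF Kf vector_fields_plus[OF Kf H_field] f(3,4) x]
        metric_lie_plus[OF Kf H_field f(3,4) x]
      by simp
  qed
  moreover have "metric_lie H U V x = ?f H x * g x (U x) (V x)"
    by (rule conformal[OF H U V x])
  moreover have "g x (H x) (\<tau> x) = g x (D X Y x) (\<tau> x) - g x (D Y X x) (\<tau> x)"
  proof -
    have "g x (K x) (\<tau> x) = 0"
      by (rule horizontal_vertical(2)[OF horizontal_fields_horizontal[OF \<tau> x]
            vertical_fields_vertical[OF K x]])
    then show ?thesis
      by (simp add: g_H[OF x vector_fields_tangent[OF \<tau>f x]])
  qed
  moreover have "g x (Y x) (D X \<tau> x) = g x (D X \<tau> x) (Y x)"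
    "g x (X x) (D Y \<tau> x) = g x (D Y \<tau> x) (X x)"
    using g_sym connection_tangent[OF _ \<tau>f x] vector_fields_tangent[OF _ x] f by blast+
  ultimately have "2 * metric_lie K U V x = 2 * (- (1 / real p) *
      (g x (D X \<tau> x) (Y x) - g x (D Y \<tau> x) (X x)) * g x (U x) (V x))"
    unfolding f_deriv[OF f(1,2)] f_deriv[OF f(2,1)] by (simp add: algebra_simps)
  then show ?thesis
    unfolding K_def by (simp only: mult_cancel_left) simp
qed

lemma killing_along_leaves_oneill_A_iff:
  assumes bl: "bundle_like" and umb: "totally_umbilical"
    and X: "X \<in> basic_fields W" and Y: "Y \<in> basic_fields W"
  defines "\<tau> \<equiv> mean_curvature"
  shows "killing_along_leaves W (oneill_A X Y) \<longleftrightarrow>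
    (\<forall>x\<in>W. g x (D X \<tau> x) (Y x) = g x (D Y \<tau> x) (X x))"
proof -
  let ?A = "oneill_A X Y"
  have W: "open W"
    by (rule vector_fields_open[OF basic_fields_field[OF X]])
  have A_eq: "vert (D X Y) x = ?A x" if "x \<in> W" for x
    by (rule oneill_A_horizontal[OF basic_fields_horizontal[OF X] basic_fields_horizontal[OF Y] that,
          symmetric])
  note vA = vert_field[OF connection_field[OF basic_fields_field[OF X] basic_fields_field[OF Y]]]
  have A: "?A \<in> vertical_fields W"
    using vA vector_fields_cong[OF vertical_fields_field[OF vA] A_eq] A_eq
    by (simp add: vertical_fields_def)
  have key: "g x (D U ?A x) (V x) + g x (D V ?A x) (U x) =
      - (1 / real p) * (g x (D X \<tau> x) (Y x) - g x (D Y \<tau> x) (X x)) * g x (U x) (V x)"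
    if N: "N \<subseteq> W" and U: "U \<in> vertical_fields N" and V: "V \<in> vertical_fields N" and x: "x \<in> N"
    for N U V x
  proof -
    note Uf = vertical_fields_field[OF U] and Vf = vertical_fields_field[OF V]
    note Nopen = vector_fields_open[OF Uf]
    note AN = vector_fields_subset[OF vertical_fields_field[OF vA] Nopen N]
    have "D P ?A x = D P (vert (D X Y)) x" if "P \<in> vector_fields N" for P
      by (rule connection_cong[OF that AN _ _ x, symmetric]) (use A_eq N in auto)
    moreover have "g x (D V (vert (D X Y)) x) (U x) = g x (U x) (D V (vert (D X Y)) x)"
      by (rule g_sym[OF connection_tangent[OF Vf AN x] vector_fields_tangent[OF Uf x]])
    ultimately show ?thesis
      using metric_lie_oneill_A[OF bl umb basic_fields_subset[OF X Nopen N]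
          basic_fields_subset[OF Y Nopen N] U V x] Uf Vf
      by (simp add: metric_lie_def \<tau>_def)
  qed
  show ?thesis
  proof
    assume killing: "killing_along_leaves W ?A"
    show "\<forall>x\<in>W. g x (D X \<tau> x) (Y x) = g x (D Y \<tau> x) (X x)"
    proof
      fix x assume x: "x \<in> W"
      obtain N U where N: "x \<in> N" "N \<subseteq> W" and U: "U \<in> vertical_fields N"
        and nz: "\<forall>y\<in>N. U y \<noteq> 0"
        by (rule nonvanishing_vertical_field[OF W x])
      have "g x (U x) (U x) > 0"
        by (rule g_pos[OF vector_fields_tangent[OF vertical_fields_field[OF U] N(1)] bspec[OF nz N(1)]])
      moreover have "g x (D U ?A x) (U x) + g x (D U ?A x) (U x) = 0"
        using killing N U unfolding killing_along_leaves_def by blast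
      ultimately show "g x (D X \<tau> x) (Y x) = g x (D Y \<tau> x) (X x)"
        using key[OF N(2) U U N(1)] leaf_dimension(2) by simp
    qed
  next
    assume sym: "\<forall>x\<in>W. g x (D X \<tau> x) (Y x) = g x (D Y \<tau> x) (X x)"
    have "g x (D U ?A x) (V x) + g x (D V ?A x) (U x) = 0"
      if N: "N \<subseteq> W" "U \<in> vertical_fields N" "V \<in> vertical_fields N" "x \<in> N" for N U V x
      using key[OF N] sym N(1,4) by auto
    with A show "killing_along_leaves W ?A"
      unfolding killing_along_leaves_def by blast
  qed
qed

end

theorem proposition2p3:
  fixes \<A> \<F> :: "('a::{t2_space, second_countable_topology}, 'm::euclidean_space) chart set"
    and B :: "'m set" and p :: nat
    and g :: "'a \<Rightarrow> 'a tangent \<Rightarrow> 'a tangent \<Rightarrow> real"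
    and D :: "'a vfield \<Rightarrow> 'a vfield \<Rightarrow> 'a vfield"
    and X Y \<tau> :: "'a vfield" and W :: "'a set"
  assumes "foliated_riemannian \<A> \<F> B p g D"
    and "foliated_riemannian.bundle_like \<A> \<F> B g"
    and "foliated_riemannian.totally_umbilical \<A> \<F> B p g D"
    and "X \<in> foliated_riemannian.basic_fields \<A> \<F> B g W"
    and "Y \<in> foliated_riemannian.basic_fields \<A> \<F> B g W"
    and "\<tau> = foliated_riemannian.mean_curvature \<A> \<F> B p g D"
  shows "foliated_riemannian.killing_along_leaves \<A> \<F> B g D W
           (foliated_riemannian.oneill_A \<A> \<F> B g D X Y) \<longleftrightarrow>
         (\<forall>x\<in>W. g x (D X \<tau> x) (Y x) = g x (D Y \<tau> x) (X x))"
  using foliated_riemannian.killing_along_leaves_oneill_A_iff[OF assms(1-5)] assms(6) by simp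

end
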